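(* Let $\Gamma=(K,I,J,g,q)$ be a two-player zero-sum stochastic game with finite state space $K$ and finite action sets $I$ and $J$. For any optimal Puiseux strategy profile $(x^1_\lambda,x^2_\lambda)_{\lambda\in(0,1]}$, $$\lim_{\lambda\to0}\gamma_\lambda(k,x^1_\lambda,x^2_\lambda;t)=t\,v^*(k)\qquad\text{for all } t\in[0,1]\text{ and all }k\in K.$$
   Context: For a finite or countable set $X$, $\Delta(X)$ is the set of probability distributions on $X$. A two-player zero-sum stochastic game is a tuple $\Gamma=(K,I,J,g,q)$ with $K$ the (finite) state space, $I,J$ the (finite) action sets of Players 1 and 2, $g:K\times I\times J\to\mathbb{R}$ the payoff function and $q:K\times I\times J\to\Delta(K)$ the transition function. At every stage $m\ge1$, knowing the current state $k_m$ (and the past history), the players independently choose actions $i_m,j_m$; Player 1 receives $g(k_m,i_m,j_m)$, Player 2 receives $-g(k_m,i_m,j_m)$; the next state $k_{m+1}$ is drawn from $q(\cdot\,|\,k_m,i_m,j_m)$, and the players observe $(i_m,j_m)$ and $k_{m+1}$. A strategy of Player 1 is $\sigma^1=(\sigma^1_m)_{m\ge1}$ with $\sigma^1_m:(K\times I\times J)^{m-1}\times K\to\Delta(I)$; a strategy of Player 2 is $\sigma^2=(\sigma^2_m)_{m\ge1}$ with $\sigma^2_m:(K\times I\times J)^{m-1}\times K\to\Delta(J)$. The sets of strategies are $\Sigma^1,\Sigma^2$. A stationary strategy plays according to the current state only: it is a map $x^1:K\to\Delta(I)$ for Player 1, $x^2:K\to\Delta(J)$ for Player 2; $x^1(k,i)$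 is the probability of action $i$ in state $k$, and similarly $x^2(k,j)$. An initial state $k_1=k$ and a pair $(\sigma^1,\sigma^2)$ induce a unique probability measure on plays $(K\times I\times J)^{\mathbb{N}}$, with expectation $\mathbb{E}^k_{\sigma^1,\sigma^2}$. For $\lambda\in(0,1]$ and $k\in K$, let $\gamma_\lambda(k,\sigma^1,\sigma^2)=\mathbb{E}^k_{\sigma^1,\sigma^2}\big[\sum_{m\ge1}\lambda(1-\lambda)^{m-1}g(k_m,i_m,j_m)\big]$. By Shapley, the $\lambda$-discounted game has a value $v_\lambda(k)=\max_{\sigma^1\in\Sigma^1}\min_{\sigma^2\in\Sigma^2}\gamma_\lambda(k,\sigma^1,\sigma^2)=\min_{\sigma^2\in\Sigma^2}\max_{\sigma^1\in\Sigma^1}\gamma_\lambda(k,\sigma^1,\sigma^2)$. A strategy $\sigma^1$ is optimal in $\Gamma_\lambda$ if for every $k\in K$ it attains the outer maximum in the max-min expression; a strategy $\sigma^2$ is optimal in $\Gamma_\lambda$ if for every $k\in K$ it attains the outer minimum in the min-max expression. By Bewley and Kohlberg, $v^*(k):=\lim_{\lambda\to0}v_\lambda(k)$ exists for each $k\in K$. A map $f$ is a Puiseux series on $(0,\lambda_0)$ if there exist $m_0\in\mathbb{Z}$, an integer $N\ge1$ and reals $(c_m)_{m\ge m_0}$ such that $f(\lambda)=\sum_{m\ge m_0}c_m\lambda^{m/N}$ for all $\lambda\in(0,\lambda_0)$. A Puiseux strategy profile is a family of pairs of stationary strategies $(x^1_\lambda,x^2_\lambda)_{\lambda\in(0,1]}$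 such that for some $\lambda_0\in(0,1]$ the maps $\lambda\mapsto x^1_\lambda(k,i)$ and $\lambda\mapsto x^2_\lambda(k,j)$ are bounded real Puiseux series on $(0,\lambda_0)$ for all $(k,i,j)\in K\times I\times J$. It is an optimal Puiseux strategy profile if moreover, for all $\lambda\in(0,\lambda_0]$, $x^1_\lambda$ and $x^2_\lambda$ are optimal in $\Gamma_\lambda$. For $M\in\mathbb{N}$ let $\eta(\lambda,M)=\sum_{m=1}^M\lambda(1-\lambda)^{m-1}$, and for $t\in[0,1]$ let $\varphi(\lambda,t)=\inf\{M\ge1:\eta(\lambda,M)\ge t\}\in\mathbb{N}\cup\{+\infty\}$. The cumulated payoff at time $t\in[0,1]$ is $$\gamma_\lambda(k,\sigma^1,\sigma^2;t)=\mathbb{E}^k_{\sigma^1,\sigma^2}\Big[\sum_{m=1}^{\varphi(\lambda,t)}\lambda(1-\lambda)^{m-1}g(k_m,i_m,j_m)\Big].$$ *)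

theory Defs
  imports "HOL-Probability.Probability"
begin

text \<open>
  A game with states \<open>'k\<close> and actions \<open>'i\<close>, \<open>'j\<close> (finite types) is given by its payoff
  \<open>g :: 'k \<Rightarrow> 'i \<Rightarrow> 'j \<Rightarrow> real\<close> and its transition \<open>q :: 'k \<Rightarrow> 'i \<Rightarrow> 'j \<Rightarrow> 'k pmf\<close>.
\<close>

text \<open>
  A strategy maps the past and the current state to a mixed action. The past is a list, oldest
  stage first; the restriction to lists of length \<open>m - 1\<close> is the strategy at stage \<open>m\<close>.
\<close>

type_synonym ('k, 'i, 'j, 'a) strategy = "('k \<times> 'i \<times> 'j) list \<Rightarrow> 'k \<Rightarrow> 'a pmf"

definition stationary :: "('k \<Rightarrow> 'a pmf) \<Rightarrow> ('k, 'i, 'j, 'a) strategy" where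
  "stationary x = (\<lambda>h. x)"

definition state_law :: "('k \<Rightarrow> 'i \<Rightarrow> 'j \<Rightarrow> 'k pmf) \<Rightarrow> 'k \<Rightarrow> ('k \<times> 'i \<times> 'j) list \<Rightarrow> 'k pmf" where
  "state_law q k h = (if h = [] then return_pmf k else (case last h of (s, i, j) \<Rightarrow> q s i j))"

definition stage_law ::
  "('k \<Rightarrow> 'i \<Rightarrow> 'j \<Rightarrow> 'k pmf) \<Rightarrow> 'k \<Rightarrow> ('k, 'i, 'j, 'i) strategy \<Rightarrow> ('k, 'i, 'j, 'j) strategy
    \<Rightarrow> ('k \<times> 'i \<times> 'j) list \<Rightarrow> ('k \<times> 'i \<times> 'j) pmf" where
  "stage_law q k \<sigma>1 \<sigma>2 h =
     do { s \<leftarrow> state_law q k h; i \<leftarrow> \<sigma>1 h s; j \<leftarrow> \<sigma>2 h s; return_pmf (s, i, j) }"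

text \<open>
  Plays are functions \<open>nat \<Rightarrow> 'k \<times> 'i \<times> 'j\<close> whose value at \<open>m\<close> is stage \<open>m + 1\<close>. Their law is the
  Ionescu-Tulcea measure of the kernels \<open>stage_law\<close>.
\<close>

definition play_kernel ::
  "('k \<Rightarrow> 'i \<Rightarrow> 'j \<Rightarrow> 'k pmf) \<Rightarrow> 'k \<Rightarrow> ('k, 'i, 'j, 'i) strategy \<Rightarrow> ('k, 'i, 'j, 'j) strategy
    \<Rightarrow> nat \<Rightarrow> (nat \<Rightarrow> 'k \<times> 'i \<times> 'j) \<Rightarrow> ('k \<times> 'i \<times> 'j) measure" where
  "play_kernel q k \<sigma>1 \<sigma>2 m \<omega> = measure_pmf (stage_law q k \<sigma>1 \<sigma>2 (map \<omega> [0..<m]))"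

definition play_measure ::
  "('k \<Rightarrow> 'i \<Rightarrow> 'j \<Rightarrow> 'k pmf) \<Rightarrow> 'k \<Rightarrow> ('k, 'i, 'j, 'i) strategy \<Rightarrow> ('k, 'i, 'j, 'j) strategy
    \<Rightarrow> (nat \<Rightarrow> 'k \<times> 'i \<times> 'j) measure" where
  "play_measure q k \<sigma>1 \<sigma>2 =
     projective_family.lim UNIV
       (Ionescu_Tulcea.CI (play_kernel q k \<sigma>1 \<sigma>2) (\<lambda>_. count_space UNIV))
       (\<lambda>_. count_space UNIV)"

lemma Ionescu_Tulcea_play_kernel:
  fixes q :: "'k::finite \<Rightarrow> 'i::finite \<Rightarrow> 'j::finite \<Rightarrow> 'k pmf"
  shows "Ionescu_Tulcea (play_kernel q k \<sigma>1 \<sigma>2) (\<lambda>_. count_space UNIV)"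
proof (rule Ionescu_Tulcea.intro)
  fix m :: nat
  let ?S = "count_space UNIV :: ('k \<times> 'i \<times> 'j) measure"
  have eq: "Pi\<^sub>M {0..<m} (\<lambda>_. ?S) = count_space (PiE {0..<m} (\<lambda>_. UNIV))"
    by (intro count_space_PiM_finite) auto
  show "play_kernel q k \<sigma>1 \<sigma>2 m \<in> measurable (Pi\<^sub>M {0..<m} (\<lambda>_. ?S)) (subprob_algebra ?S)"
    unfolding eq by (auto simp: play_kernel_def space_subprob_algebra
        intro: measure_pmf.subprob_space_axioms)
next
  fix m \<omega>
  show "prob_space (play_kernel q k \<sigma>1 \<sigma>2 m \<omega>)"
    unfolding play_kernel_def by (rule measure_pmf.prob_space_axioms)
qed

definition discounted_payoff ::
  "('k \<Rightarrow> 'i \<Rightarrow> 'j \<Rightarrow> real) \<Rightarrow> ('k \<Rightarrow> 'i \<Rightarrow> 'j \<Rightarrow> 'k pmf) \<Rightarrow> real \<Rightarrow> 'k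
    \<Rightarrow> ('k, 'i, 'j, 'i) strategy \<Rightarrow> ('k, 'i, 'j, 'j) strategy \<Rightarrow> real" where
  "discounted_payoff g q lam k \<sigma>1 \<sigma>2 =
     (\<integral>\<omega>. (\<Sum>m. lam * (1 - lam) ^ m * (case \<omega> m of (s, i, j) \<Rightarrow> g s i j)) \<partial>play_measure q k \<sigma>1 \<sigma>2)"

definition max_min ::
  "('k \<Rightarrow> 'i \<Rightarrow> 'j \<Rightarrow> real) \<Rightarrow> ('k \<Rightarrow> 'i \<Rightarrow> 'j \<Rightarrow> 'k pmf) \<Rightarrow> real \<Rightarrow> 'k \<Rightarrow> real" where
  "max_min g q lam k = (SUP \<sigma>1. INF \<sigma>2. discounted_payoff g q lam k \<sigma>1 \<sigma>2)"

definition min_max ::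
  "('k \<Rightarrow> 'i \<Rightarrow> 'j \<Rightarrow> real) \<Rightarrow> ('k \<Rightarrow> 'i \<Rightarrow> 'j \<Rightarrow> 'k pmf) \<Rightarrow> real \<Rightarrow> 'k \<Rightarrow> real" where
  "min_max g q lam k = (INF \<sigma>2. SUP \<sigma>1. discounted_payoff g q lam k \<sigma>1 \<sigma>2)"

text \<open>
  By Shapley's theorem \<open>max_min\<close> and \<open>min_max\<close> coincide for \<open>0 < lam \<le> 1\<close>, and all suprema and infima
  in them are attained; the common number is the value.
\<close>

definition discounted_value ::
  "('k \<Rightarrow> 'i \<Rightarrow> 'j \<Rightarrow> real) \<Rightarrow> ('k \<Rightarrow> 'i \<Rightarrow> 'j \<Rightarrow> 'k pmf) \<Rightarrow> real \<Rightarrow> 'k \<Rightarrow> real" where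
  "discounted_value g q lam k = max_min g q lam k"

definition optimal1 ::
  "('k \<Rightarrow> 'i \<Rightarrow> 'j \<Rightarrow> real) \<Rightarrow> ('k \<Rightarrow> 'i \<Rightarrow> 'j \<Rightarrow> 'k pmf) \<Rightarrow> real
    \<Rightarrow> ('k, 'i, 'j, 'i) strategy \<Rightarrow> bool" where
  "optimal1 g q lam \<sigma>1 \<longleftrightarrow>
     (\<forall>k. (INF \<sigma>2. discounted_payoff g q lam k \<sigma>1 \<sigma>2) = max_min g q lam k)"

definition optimal2 ::
  "('k \<Rightarrow> 'i \<Rightarrow> 'j \<Rightarrow> real) \<Rightarrow> ('k \<Rightarrow> 'i \<Rightarrow> 'j \<Rightarrow> 'k pmf) \<Rightarrow> real
    \<Rightarrow> ('k, 'i, 'j, 'j) strategy \<Rightarrow> bool" where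
  "optimal2 g q lam \<sigma>2 \<longleftrightarrow>
     (\<forall>k. (SUP \<sigma>1. discounted_payoff g q lam k \<sigma>1 \<sigma>2) = min_max g q lam k)"

text \<open>The limit exists by the theorem of Bewley and Kohlberg.\<close>

definition limit_value ::
  "('k \<Rightarrow> 'i \<Rightarrow> 'j \<Rightarrow> real) \<Rightarrow> ('k \<Rightarrow> 'i \<Rightarrow> 'j \<Rightarrow> 'k pmf) \<Rightarrow> 'k \<Rightarrow> real" where
  "limit_value g q k = Lim (at_right 0) (\<lambda>lam. discounted_value g q lam k)"

definition puiseux_on :: "real \<Rightarrow> (real \<Rightarrow> real) \<Rightarrow> bool" where
  "puiseux_on lam0 f \<longleftrightarrow>
     (\<exists>(m0::int) (N::nat) (c::int \<Rightarrow> real). N \<ge> 1 \<and>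
        (\<forall>lam\<in>{0<..<lam0}.
           (\<lambda>n. c (m0 + int n) * lam powr (real_of_int (m0 + int n) / real N)) sums f lam))"

text \<open>
  Families indexed by \<open>lam \<in> (0,1]\<close> are functions on \<open>real\<close>; values outside \<open>(0,1]\<close> play no role.
\<close>

definition puiseux_profile_on ::
  "real \<Rightarrow> (real \<Rightarrow> 'k \<Rightarrow> 'i pmf) \<Rightarrow> (real \<Rightarrow> 'k \<Rightarrow> 'j pmf) \<Rightarrow> bool" where
  "puiseux_profile_on lam0 x1 x2 \<longleftrightarrow>
     (\<forall>k i. puiseux_on lam0 (\<lambda>lam. pmf (x1 lam k) i) \<and>
            bounded ((\<lambda>lam. pmf (x1 lam k) i) ` {0<..<lam0})) \<and>
     (\<forall>k j. puiseux_on lam0 (\<lambda>lam. pmf (x2 lam k) j) \<and>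
            bounded ((\<lambda>lam. pmf (x2 lam k) j) ` {0<..<lam0}))"

definition optimal_puiseux_profile ::
  "('k \<Rightarrow> 'i \<Rightarrow> 'j \<Rightarrow> real) \<Rightarrow> ('k \<Rightarrow> 'i \<Rightarrow> 'j \<Rightarrow> 'k pmf)
    \<Rightarrow> (real \<Rightarrow> 'k \<Rightarrow> 'i pmf) \<Rightarrow> (real \<Rightarrow> 'k \<Rightarrow> 'j pmf) \<Rightarrow> bool" where
  "optimal_puiseux_profile g q x1 x2 \<longleftrightarrow>
     (\<exists>lam0\<in>{0<..1}. puiseux_profile_on lam0 x1 x2 \<and>
        (\<forall>lam\<in>{0<..lam0}. optimal1 g q lam (stationary (x1 lam)) \<and> optimal2 g q lam (stationary (x2 lam))))"

definition eta :: "real \<Rightarrow> nat \<Rightarrow> real" where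
  "eta lam M = (\<Sum>m = 1..M. lam * (1 - lam) ^ (m - 1))"

text \<open>The infimum of the empty set of extended naturals is \<open>\<infinity>\<close>.\<close>

definition phi :: "real \<Rightarrow> real \<Rightarrow> enat" where
  "phi lam t = Inf {enat M | M. M \<ge> 1 \<and> eta lam M \<ge> t}"

definition cumulated_payoff ::
  "('k \<Rightarrow> 'i \<Rightarrow> 'j \<Rightarrow> real) \<Rightarrow> ('k \<Rightarrow> 'i \<Rightarrow> 'j \<Rightarrow> 'k pmf) \<Rightarrow> real \<Rightarrow> 'k
    \<Rightarrow> ('k, 'i, 'j, 'i) strategy \<Rightarrow> ('k, 'i, 'j, 'j) strategy \<Rightarrow> real \<Rightarrow> real" where
  "cumulated_payoff g q lam k \<sigma>1 \<sigma>2 t =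
     (\<integral>\<omega>. (\<Sum>m. if enat (Suc m) \<le> phi lam t
                  then lam * (1 - lam) ^ m * (case \<omega> m of (s, i, j) \<Rightarrow> g s i j) else 0)
       \<partial>play_measure q k \<sigma>1 \<sigma>2)"

end

theory Submission
  imports Defs
begin

text \<open>
  Let \<open>v\<close> be the value, \<open>Q\<close> the transition matrix and \<open>r\<close> the stage payoff under the optimal stationary
  pair at discount rate \<open>\<lambda>\<close>, so that \<open>v = \<lambda> r + (1 - \<lambda>) Q v\<close>. The payoff cumulated over the first \<open>M\<close>
  stages is \<open>v - (1 - \<lambda>)\<^sup>M Q\<^sup>M v\<close>, and \<open>(1 - \<lambda>)\<^sup>M \<longlonglongrightarrow> 1 - t\<close> for \<open>M = \<phi>(\<lambda>, t)\<close>, so everything reduces to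
  \<open>Q\<^sup>M v - v \<longlonglongrightarrow> 0\<close>.

  Comparing the payoffs at the rates \<open>\<lambda>\<close> and \<open>\<mu>\<close> by the saddle point inequalities and letting \<open>\<mu>\<close> tend to
  \<open>\<lambda>\<close> from above gives the envelope formula: \<open>D = \<lambda> dv/d\<lambda>\<close> solves \<open>D - (1 - \<lambda>) Q D = v - Q v\<close>. Summing
  along the chain yields \<open>|v - Q\<^sup>M v| \<le> (2 + \<lambda> M) max |D|\<close>, where \<open>\<lambda> M\<close> stays bounded for \<open>t < 1\<close>. By
  Cramer's rule \<open>v\<close> is a bounded quotient of power series in \<open>s = \<lambda>\<^bsup>1/N\<^esup>\<close>, hence a power series \<open>h(s)\<close>,
  and \<open>D = s h'(s) / N\<close> tends to \<open>0\<close>.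

  The saddle point inequalities need Shapley's theorem; it follows from Brouwer's fixed point theorem,
  applied to Nash's map for the local games with the candidate value as additional coordinate.
\<close>

section \<open>Stage laws of the play measure\<close>

text \<open>The law of the first \<open>m\<close> stages as a \<open>pmf\<close> on lists. Its
  support is finite, so expectations under it avoid the product measure.\<close>

primrec history_law ::
  "('k \<Rightarrow> 'i \<Rightarrow> 'j \<Rightarrow> 'k pmf) \<Rightarrow> 'k \<Rightarrow> ('k, 'i, 'j, 'i) strategy \<Rightarrow> ('k, 'i, 'j, 'j) strategy
    \<Rightarrow> nat \<Rightarrow> ('k \<times> 'i \<times> 'j) list pmf" where
  "history_law q k \<sigma>1 \<sigma>2 0 = return_pmf []"
| "history_law q k \<sigma>1 \<sigma>2 (Suc m) =
     bind_pmf (history_law q k \<sigma>1 \<sigma>2 m) (\<lambda>h. map_pmf (\<lambda>z. h @ [z]) (stage_law q k \<sigma>1 \<sigma>2 h))"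

text \<open>The index set \<open>I\<close> stays general because prefixes are read off both from
  finite products over \<open>{0..<m}\<close> and from the full product over
  \<open>UNIV\<close>.\<close>

lemma measurable_map_upt:
  assumes "{0..<m} \<subseteq> I"
  shows "(\<lambda>\<omega>. map \<omega> [0..<m]) \<in> measurable (PiM I (\<lambda>_. count_space (UNIV :: 'a::countable set)))
    (count_space UNIV)"
  using assms
proof (induction m)
  case 0
  show ?case by simp
next
  case (Suc m)
  have 1: "(\<lambda>\<omega>. map \<omega> [0..<m]) \<in> measurable (PiM I (\<lambda>_. count_space (UNIV :: 'a set))) (count_space UNIV)"
    using Suc.prems by (intro Suc.IH) (auto simp: subset_iff)
  have 2: "(\<lambda>\<omega>. \<omega> m) \<in> measurable (PiM I (\<lambda>_. count_space (UNIV :: 'a set))) (count_space UNIV)"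
    using Suc.prems by (intro measurable_component_singleton) auto
  have "(\<lambda>\<omega>. (\<lambda>h. map \<omega> [0..<m] @ [h]) (\<omega> m)) \<in> measurable (PiM I (\<lambda>_. count_space (UNIV :: 'a set))) (count_space UNIV)"
    by (rule measurable_compose_countable'[OF _ 2]) (auto intro: measurable_compose[OF 1])
  then show ?case by simp
qed

text \<open>The finite-dimensional laws \<open>IT.C 0 m\<close> arise by adjoining one coordinate at
  a time, which mirrors the recursion of \<open>history_law\<close>; the projective limit has
  exactly these laws as marginals.\<close>

lemma distr_play_measure:
  fixes q :: "'k::finite \<Rightarrow> 'i::finite \<Rightarrow> 'j::finite \<Rightarrow> 'k pmf"
  shows "distr (play_measure q k \<sigma>1 \<sigma>2) (count_space UNIV) (\<lambda>\<omega>. map \<omega> [0..<m])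
    = measure_pmf (history_law q k \<sigma>1 \<sigma>2 m)"
proof -
  let ?S = "count_space UNIV :: ('k \<times> 'i \<times> 'j) measure"
  let ?P = "play_kernel q k \<sigma>1 \<sigma>2"
  interpret IT: Ionescu_Tulcea ?P "\<lambda>_. ?S"
    by (rule Ionescu_Tulcea_play_kernel)
  \<comment> \<open>The only point of the empty product, hence the starting point of the iterated
    kernels.\<close>
  let ?u = "\<lambda>_::nat. undefined :: 'k \<times> 'i \<times> 'j"
  have u: "?u \<in> space (PiM {0..<0} (\<lambda>_. ?S))" by (simp add: space_PiM)
  have C: "distr (IT.C 0 m ?u) (count_space UNIV) (\<lambda>\<omega>. map \<omega> [0..<m])
    = measure_pmf (history_law q k \<sigma>1 \<sigma>2 m)" for m
  proof (induction m)
    case 0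
    show ?case by (simp add: distr_return return_pmf.rep_eq space_PiM)
  next
    case (Suc m)
    let ?F = "\<lambda>h. map_pmf (\<lambda>z. h @ [z]) (stage_law q k \<sigma>1 \<sigma>2 h)"
    have ne: "space (IT.C 0 m ?u) \<noteq> {}"
      using IT.prob_space_C[OF u, of m] prob_space.not_empty by blast
    have sC: "sets (IT.C 0 m ?u) = sets (PiM {0..<m} (\<lambda>_. ?S))"
      using IT.sets_C[OF u, of m] by simp
    have m1: "IT.eP m \<in> measurable (IT.C 0 m ?u) (subprob_algebra (PiM {0..<Suc m} (\<lambda>_. ?S)))"
      using IT.measurable_eP[of m] by (simp cong: measurable_cong_sets add: measurable_cong_sets[OF sC refl])
    have m2: "(\<lambda>\<omega>. map \<omega> [0..<m]) \<in> measurable (IT.C 0 m ?u) (count_space UNIV)"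
      using measurable_map_upt[of m "{0..<m}"] by (simp add: measurable_cong_sets[OF sC refl])
    \<comment> \<open>The kernel \<open>IT.eP m\<close> sets coordinate \<open>m\<close> to a draw
      from \<open>?P m\<close>, so on prefixes it appends one entry.\<close>
    have "distr (IT.C 0 (Suc m) ?u) (count_space UNIV) (\<lambda>\<omega>. map \<omega> [0..<Suc m])
       = IT.C 0 m ?u \<bind> (\<lambda>\<omega>. distr (IT.eP m \<omega>) (count_space UNIV) (\<lambda>\<omega>. map \<omega> [0..<Suc m]))"
      using distr_bind[OF m1 ne measurable_map_upt[of "Suc m" "{0..<Suc m}"]] by simp
    also have "\<dots> = IT.C 0 m ?u \<bind> (\<lambda>\<omega>. measure_pmf (?F (map \<omega> [0..<m])))"
    proof (rule bind_cong[OF refl])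
      fix \<omega> assume "\<omega> \<in> space (IT.C 0 m ?u)"
      then have \<omega>: "\<omega> \<in> space (PiM {0..<m} (\<lambda>_. ?S))" using IT.space_C[OF u, of m] by simp
      have m3: "fun_upd \<omega> m \<in> measurable (?P m \<omega>) (PiM {0..<Suc m} (\<lambda>_. ?S))"
        using \<omega> by (intro measurable_fun_upd[where J="{0..<m}"]) (auto simp: play_kernel_def space_PiM)
      have "distr (IT.eP m \<omega>) (count_space UNIV) (\<lambda>\<omega>. map \<omega> [0..<Suc m])
        = distr (?P m \<omega>) (count_space UNIV) ((\<lambda>\<omega>. map \<omega> [0..<Suc m]) \<circ> fun_upd \<omega> m)"
        unfolding IT.eP_def by (rule distr_distr[OF measurable_map_upt m3]) simp
      also have "(\<lambda>\<omega>. map \<omega> [0..<Suc m]) \<circ> fun_upd \<omega> m = (\<lambda>z. map \<omega> [0..<m] @ [z])"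
        by (auto simp: fun_eq_iff)
      also have "?P m \<omega> = measure_pmf (stage_law q k \<sigma>1 \<sigma>2 (map \<omega> [0..<m]))"
        by (simp add: play_kernel_def)
      finally show "distr (IT.eP m \<omega>) (count_space UNIV) (\<lambda>\<omega>. map \<omega> [0..<Suc m]) = measure_pmf (?F (map \<omega> [0..<m]))"
        unfolding map_pmf_rep_eq .
    qed
    also have "\<dots> = distr (IT.C 0 m ?u) (count_space UNIV) (\<lambda>\<omega>. map \<omega> [0..<m]) \<bind> (\<lambda>h. measure_pmf (?F h))"
      by (rule bind_distr[symmetric, OF m2 _ ne, where K = "count_space UNIV"])
        (auto simp: space_subprob_algebra intro: measure_pmf.subprob_space_axioms)
    also have "\<dots> = measure_pmf (history_law q k \<sigma>1 \<sigma>2 (Suc m))"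
      unfolding Suc by (simp add: measure_pmf_bind)
    finally show ?case .
  qed
  \<comment> \<open>This identifies the marginal \<open>IT.CI {0..<m}\<close> as a projection of
    \<open>IT.C 0 m\<close>.\<close>
  have up: "IT.up_to {0..<m} = m"
    unfolding IT.up_to_def by (rule Least_equality) (auto simp: not_less[symmetric])
  have eq: "play_measure q k \<sigma>1 \<sigma>2 = IT.PF.lim"
    by (simp add: play_measure_def)
  \<comment> \<open>A prefix depends only on the coordinates below \<open>m\<close>, so restricting
    beforehand changes nothing.\<close>
  have r: "(\<lambda>\<omega>. map \<omega> [0..<m]) = (\<lambda>\<omega>. map \<omega> [0..<m]) \<circ> (\<lambda>x. restrict x {0..<m})"
    by (auto simp: fun_eq_iff)
  have m4: "(\<lambda>x. restrict x {0..<m}) \<in> measurable M (PiM {0..<m} (\<lambda>_. ?S))"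
    if "sets M = sets (PiM I (\<lambda>_. ?S))" "{0..<m} \<subseteq> I" for M :: "(nat \<Rightarrow> 'k \<times> 'i \<times> 'j) measure" and I
    using that by (auto simp: measurable_cong_sets[OF that(1) refl] intro!: measurable_restrict measurable_component_singleton)
  have sL: "sets IT.PF.lim = sets (PiM UNIV (\<lambda>_. ?S))" by simp
  have "distr IT.PF.lim (count_space UNIV) (\<lambda>\<omega>. map \<omega> [0..<m])
    = distr (distr IT.PF.lim (PiM {0..<m} (\<lambda>_. ?S)) (\<lambda>x. restrict x {0..<m})) (count_space UNIV) (\<lambda>\<omega>. map \<omega> [0..<m])"
    by (subst distr_distr[OF measurable_map_upt m4[OF sL]]) (auto simp: r[symmetric])
  also have "\<dots> = distr (IT.CI {0..<m}) (count_space UNIV) (\<lambda>\<omega>. map \<omega> [0..<m])"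
    by (subst IT.distr_lim) auto
  also have "\<dots> = distr (IT.C 0 m ?u) (count_space UNIV) (\<lambda>\<omega>. map \<omega> [0..<m])"
    unfolding IT.CI_def up
    by (subst distr_distr[OF measurable_map_upt m4[OF IT.sets_C[OF u]]]) (auto simp: r[symmetric])
  finally show ?thesis by (simp add: eq C)
qed

lemma measurable_play_measure:
  fixes q :: "'k::finite \<Rightarrow> 'i::finite \<Rightarrow> 'j::finite \<Rightarrow> 'k pmf"
  shows "(\<lambda>\<omega>. f (\<omega> m)) \<in> borel_measurable (play_measure q k \<sigma>1 \<sigma>2)"
    "(\<lambda>\<omega>. map \<omega> [0..<m]) \<in> measurable (play_measure q k \<sigma>1 \<sigma>2) (count_space UNIV)"
proof -
  interpret IT: Ionescu_Tulcea "play_kernel q k \<sigma>1 \<sigma>2" "\<lambda>_. count_space UNIV"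
    by (rule Ionescu_Tulcea_play_kernel)
  have s: "sets (play_measure q k \<sigma>1 \<sigma>2) = sets (PiM UNIV (\<lambda>_. count_space UNIV))"
    unfolding play_measure_def by simp
  show "(\<lambda>\<omega>. map \<omega> [0..<m]) \<in> measurable (play_measure q k \<sigma>1 \<sigma>2) (count_space UNIV)"
    using measurable_map_upt[of m UNIV] by (simp add: measurable_cong_sets[OF s refl])
  have "(\<lambda>\<omega>. \<omega> m) \<in> measurable (play_measure q k \<sigma>1 \<sigma>2) (count_space UNIV)"
    unfolding measurable_cong_sets[OF s refl] by (rule measurable_component_singleton) simp
  then show "(\<lambda>\<omega>. f (\<omega> m)) \<in> borel_measurable (play_measure q k \<sigma>1 \<sigma>2)"
    by (rule measurable_compose) simp
qed

text \<open>A measure with a probability measure as image is itself one; the image under the empty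
  prefix already serves.\<close>

lemma prob_space_play_measure:
  fixes q :: "'k::finite \<Rightarrow> 'i::finite \<Rightarrow> 'j::finite \<Rightarrow> 'k pmf"
  shows "prob_space (play_measure q k \<sigma>1 \<sigma>2)"
  by (rule prob_space_distrD[OF measurable_play_measure(2)[of 0]])
    (simp only: distr_play_measure measure_pmf.prob_space_axioms)

section \<open>Expectations along the play as iterated finite sums\<close>

definition mixed :: "'i::finite pmf \<Rightarrow> 'j::finite pmf \<Rightarrow> ('i \<Rightarrow> 'j \<Rightarrow> real) \<Rightarrow> real" where
  "mixed p1 p2 a = (\<Sum>i\<in>UNIV. \<Sum>j\<in>UNIV. pmf p1 i * pmf p2 j * a i j)"

definition transition ::
  "('k::finite \<Rightarrow> 'i::finite \<Rightarrow> 'j::finite \<Rightarrow> 'k pmf) \<Rightarrow> ('k \<Rightarrow> real) \<Rightarrow> 'k \<Rightarrow> 'i \<Rightarrow> 'j \<Rightarrow> real" where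
  "transition q f s i j = (\<Sum>s'\<in>UNIV. pmf (q s i j) s' * f s')"

text \<open>The state is the one at list index \<open>m\<close>, that is, at stage
  \<open>m + 1\<close>. The integrand also sees the history because general strategies do.\<close>

definition state_expectation ::
  "('k::finite \<Rightarrow> 'i::finite \<Rightarrow> 'j::finite \<Rightarrow> 'k pmf) \<Rightarrow> 'k \<Rightarrow> ('k, 'i, 'j, 'i) strategy
    \<Rightarrow> ('k, 'i, 'j, 'j) strategy \<Rightarrow> nat \<Rightarrow> (('k \<times> 'i \<times> 'j) list \<Rightarrow> 'k \<Rightarrow> real) \<Rightarrow> real" where
  "state_expectation q k \<sigma>1 \<sigma>2 m f =
     measure_pmf.expectation (history_law q k \<sigma>1 \<sigma>2 m)
       (\<lambda>h. measure_pmf.expectation (state_law q k h) (f h))"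

lemma expectation_finite:
  fixes f :: "'a::finite \<Rightarrow> real"
  shows "measure_pmf.expectation p f = (\<Sum>a\<in>UNIV. pmf p a * f a)"
  by (subst integral_measure_pmf[of UNIV]) auto

lemma finite_set_history_law [simp]:
  fixes q :: "'k::finite \<Rightarrow> 'i::finite \<Rightarrow> 'j::finite \<Rightarrow> 'k pmf"
  shows "finite (set_pmf (history_law q k \<sigma>1 \<sigma>2 m))"
  by (induction m) auto

lemma integrable_history_law [simp]:
  fixes q :: "'k::finite \<Rightarrow> 'i::finite \<Rightarrow> 'j::finite \<Rightarrow> 'k pmf" and f :: "_ \<Rightarrow> real"
  shows "integrable (measure_pmf (history_law q k \<sigma>1 \<sigma>2 m)) f"
  by (rule integrable_measure_pmf_finite) simp

lemma expectation_bind_finite: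
  fixes f :: "'b \<Rightarrow> real"
  assumes "finite (set_pmf p)" "\<And>x. x \<in> set_pmf p \<Longrightarrow> finite (set_pmf (F x))"
  shows "measure_pmf.expectation (bind_pmf p F) f =
    measure_pmf.expectation p (\<lambda>x. measure_pmf.expectation (F x) f)"
proof -
  have "finite (\<Union>x\<in>set_pmf p. set_pmf (F x))" using assms by blast
  then show ?thesis
    using assms by (subst pmf_expectation_bind[of "set_pmf p"])
      (auto simp: integral_measure_pmf[of "set_pmf p"] )
qed

lemma expectation_stage_law:
  fixes q :: "'k::finite \<Rightarrow> 'i::finite \<Rightarrow> 'j::finite \<Rightarrow> 'k pmf"
  shows "measure_pmf.expectation (stage_law q k \<sigma>1 \<sigma>2 h) F
    = measure_pmf.expectation (state_law q k h) (\<lambda>s. mixed (\<sigma>1 h s) (\<sigma>2 h s) (\<lambda>i j. F (s, i, j)))"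
  unfolding stage_law_def mixed_def
  by (simp add: expectation_bind_finite)
    (simp add: expectation_finite sum_distrib_left mult.assoc)

text \<open>The entry at index \<open>m\<close> is the last one of the prefix of length
  \<open>Suc m\<close>, whose law is known.\<close>

lemma expectation_play_measure:
  fixes q :: "'k::finite \<Rightarrow> 'i::finite \<Rightarrow> 'j::finite \<Rightarrow> 'k pmf" and F :: "_ \<Rightarrow> real"
  shows "(\<integral>\<omega>. F (\<omega> m) \<partial>play_measure q k \<sigma>1 \<sigma>2)
    = state_expectation q k \<sigma>1 \<sigma>2 m (\<lambda>h s. mixed (\<sigma>1 h s) (\<sigma>2 h s) (\<lambda>i j. F (s, i, j)))"
proof -
  have "(\<integral>\<omega>. F (\<omega> m) \<partial>play_measure q k \<sigma>1 \<sigma>2)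
     = (\<integral>\<omega>. (F \<circ> last) (map \<omega> [0..<Suc m]) \<partial>play_measure q k \<sigma>1 \<sigma>2)" by simp
  also have "\<dots> = (\<integral>h. (F \<circ> last) h \<partial>distr (play_measure q k \<sigma>1 \<sigma>2) (count_space UNIV) (\<lambda>\<omega>. map \<omega> [0..<Suc m]))"
    by (rule integral_distr[symmetric, OF measurable_play_measure(2)]) simp
  also have "\<dots> = measure_pmf.expectation (history_law q k \<sigma>1 \<sigma>2 (Suc m)) (F \<circ> last)"
    unfolding distr_play_measure ..
  also have "\<dots> = measure_pmf.expectation (history_law q k \<sigma>1 \<sigma>2 m)
      (\<lambda>h. measure_pmf.expectation (stage_law q k \<sigma>1 \<sigma>2 h) F)"
    by (simp add: expectation_bind_finite)
  finally show ?thesis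
    by (simp add: expectation_stage_law state_expectation_def)
qed

lemma state_expectation_0 [simp]:
  fixes q :: "'k::finite \<Rightarrow> 'i::finite \<Rightarrow> 'j::finite \<Rightarrow> 'k pmf"
  shows "state_expectation q k \<sigma>1 \<sigma>2 0 f = f [] k"
  by (simp add: state_expectation_def state_law_def)

text \<open>The Markov property: given the history and the current state, a function of the next
  state alone is averaged by \<open>q\<close> under the mixed actions.\<close>

lemma state_expectation_Suc:
  fixes q :: "'k::finite \<Rightarrow> 'i::finite \<Rightarrow> 'j::finite \<Rightarrow> 'k pmf"
  shows "state_expectation q k \<sigma>1 \<sigma>2 (Suc m) (\<lambda>_. f)
    = state_expectation q k \<sigma>1 \<sigma>2 m (\<lambda>h s. mixed (\<sigma>1 h s) (\<sigma>2 h s) (transition q f s))"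
proof -
  have "state_expectation q k \<sigma>1 \<sigma>2 (Suc m) (\<lambda>_. f)
    = measure_pmf.expectation (history_law q k \<sigma>1 \<sigma>2 m)
      (\<lambda>h. measure_pmf.expectation (stage_law q k \<sigma>1 \<sigma>2 h) (\<lambda>(s, i, j). transition q f s i j))"
    unfolding state_expectation_def
    by (simp add: expectation_bind_finite state_law_def case_prod_beta transition_def expectation_finite)
  then show ?thesis
    by (simp add: expectation_stage_law state_expectation_def)
qed

lemma state_expectation_mono:
  fixes q :: "'k::finite \<Rightarrow> 'i::finite \<Rightarrow> 'j::finite \<Rightarrow> 'k pmf"
  assumes "\<And>h s. f h s \<le> f' h s"
  shows "state_expectation q k \<sigma>1 \<sigma>2 m f \<le> state_expectation q k \<sigma>1 \<sigma>2 m f'"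
  unfolding state_expectation_def
  by (intro integral_mono integrable_history_law integrable_measure_pmf_finite assms) simp_all

lemma state_expectation_const [simp]:
  fixes q :: "'k::finite \<Rightarrow> 'i::finite \<Rightarrow> 'j::finite \<Rightarrow> 'k pmf"
  shows "state_expectation q k \<sigma>1 \<sigma>2 m (\<lambda>_ _. c) = c"
  by (simp add: state_expectation_def)

lemma state_expectation_linear:
  fixes q :: "'k::finite \<Rightarrow> 'i::finite \<Rightarrow> 'j::finite \<Rightarrow> 'k pmf"
  shows "state_expectation q k \<sigma>1 \<sigma>2 m (\<lambda>h s. a * f h s + b * f' h s)
    = a * state_expectation q k \<sigma>1 \<sigma>2 m f + b * state_expectation q k \<sigma>1 \<sigma>2 m f'"
proof -
  have "measure_pmf.expectation p (\<lambda>s. a * f h s + b * f' h s)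
    = a * measure_pmf.expectation p (f h) + b * measure_pmf.expectation p (f' h)" for p h
    by (subst Bochner_Integration.integral_add) (simp_all add: integrable_measure_pmf_finite)
  then show ?thesis
    unfolding state_expectation_def by (subst (3) Bochner_Integration.integral_add[symmetric] | simp)+
qed

section \<open>Discounted payoffs\<close>

lemma mixed_mono:
  assumes "\<And>i j. a i j \<le> b i j"
  shows "mixed p1 p2 a \<le> mixed p1 p2 b"
  unfolding mixed_def by (intro sum_mono mult_left_mono assms) simp

lemma mixed_const [simp]: "mixed p1 p2 (\<lambda>_ _. c) = c"
  unfolding mixed_def
  by (simp add: sum_pmf_eq_1 flip: sum_distrib_left sum_distrib_right)

lemma mixed_linear: "mixed p1 p2 (\<lambda>i j. c * a i j + d * b i j) = c * mixed p1 p2 a + d * mixed p1 p2 b"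
  unfolding mixed_def
  by (simp add: sum.distrib distrib_left mult.left_commute flip: sum_distrib_left)

lemma mixed_uminus: "mixed p1 p2 (\<lambda>i j. - a i j) = - mixed p1 p2 a"
  unfolding mixed_def by (simp add: sum_negf)

lemma mixed_sum: "mixed p1 p2 (\<lambda>i j. \<Sum>s\<in>A. a s i j * f s) = (\<Sum>s\<in>A. mixed p1 p2 (a s) * f s)"
proof (cases "finite A")
  case True
  then show ?thesis
    by (induction A) (simp_all, simp_all add: mixed_def sum.distrib distrib_left sum_distrib_right mult.assoc)
qed simp

lemma transition_uminus: "transition q (\<lambda>s. - f s) s = (\<lambda>i j. - transition q f s i j)"
  by (simp add: transition_def[abs_def] sum_negf)

lemma payoff_bounded:
  fixes g :: "'k::finite \<Rightarrow> 'i::finite \<Rightarrow> 'j::finite \<Rightarrow> real"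
  obtains B where "B \<ge> 0" "\<And>s i j. \<bar>g s i j\<bar> \<le> B"
proof
  let ?B = "\<Sum>s\<in>UNIV. \<Sum>i\<in>UNIV. \<Sum>j\<in>UNIV. \<bar>g s i j\<bar>"
  show "?B \<ge> 0" by (intro sum_nonneg) simp
  show "\<bar>g s i j\<bar> \<le> ?B" for s i j
  proof -
    have "\<bar>g s i j\<bar> \<le> (\<Sum>j\<in>UNIV. \<bar>g s i j\<bar>)" by (rule member_le_sum) auto
    also have "\<dots> \<le> (\<Sum>i\<in>UNIV. \<Sum>j\<in>UNIV. \<bar>g s i j\<bar>)"
      by (rule member_le_sum[of i UNIV "\<lambda>i. \<Sum>j\<in>UNIV. \<bar>g s i j\<bar>"]) (auto intro!: sum_nonneg)
    also have "\<dots> \<le> ?B"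
      by (rule member_le_sum[of s UNIV "\<lambda>s. \<Sum>i\<in>UNIV. \<Sum>j\<in>UNIV. \<bar>g s i j\<bar>"]) (auto intro!: sum_nonneg)
    finally show ?thesis .
  qed
qed

definition stage_payoff ::
  "('k::finite \<Rightarrow> 'i::finite \<Rightarrow> 'j::finite \<Rightarrow> real) \<Rightarrow> ('k \<Rightarrow> 'i \<Rightarrow> 'j \<Rightarrow> 'k pmf) \<Rightarrow> 'k
    \<Rightarrow> ('k, 'i, 'j, 'i) strategy \<Rightarrow> ('k, 'i, 'j, 'j) strategy \<Rightarrow> nat \<Rightarrow> real" where
  "stage_payoff g q k \<sigma>1 \<sigma>2 m = state_expectation q k \<sigma>1 \<sigma>2 m (\<lambda>h s. mixed (\<sigma>1 h s) (\<sigma>2 h s) (g s))"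

lemma state_expectation_abs_le:
  fixes q :: "'k::finite \<Rightarrow> 'i::finite \<Rightarrow> 'j::finite \<Rightarrow> 'k pmf"
  assumes "\<And>h s. \<bar>f h s\<bar> \<le> B"
  shows "\<bar>state_expectation q k \<sigma>1 \<sigma>2 m f\<bar> \<le> B"
proof -
  have "- B \<le> f h s" "f h s \<le> B" for h s using assms[of h s] by auto
  then show ?thesis
    using state_expectation_mono[of f "\<lambda>_ _. B" q k \<sigma>1 \<sigma>2 m] state_expectation_mono[of "\<lambda>_ _. - B" f q k \<sigma>1 \<sigma>2 m]
    by auto
qed

lemma mixed_abs_le:
  assumes "\<And>i j. \<bar>a i j\<bar> \<le> B"
  shows "\<bar>mixed p1 p2 a\<bar> \<le> B"
proof -
  have "- B \<le> a i j" "a i j \<le> B" for i j using assms[of i j] by auto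
  then show ?thesis
    using mixed_mono[of a "\<lambda>_ _. B" p1 p2] mixed_mono[of "\<lambda>_ _. - B" a p1 p2] by auto
qed

lemma stage_payoff_abs_le:
  assumes "\<And>s i j. \<bar>g s i j\<bar> \<le> B"
  shows "\<bar>stage_payoff g q k \<sigma>1 \<sigma>2 m\<bar> \<le> B"
  unfolding stage_payoff_def by (intro state_expectation_abs_le mixed_abs_le assms)

text \<open>Dominated interchange of sum and integral, with majorant
  \<open>\<bar>a m\<bar> * B\<close>. General weights cover both the discounted payoff and the
  payoff cut off at a finite horizon.\<close>

lemma integral_weighted_payoff:
  fixes q :: "'k::finite \<Rightarrow> 'i::finite \<Rightarrow> 'j::finite \<Rightarrow> 'k pmf"
  assumes a: "summable (\<lambda>m. \<bar>a m\<bar>)"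
  shows "(\<integral>\<omega>. (\<Sum>m. a m * (case \<omega> m of (s, i, j) \<Rightarrow> g s i j)) \<partial>play_measure q k \<sigma>1 \<sigma>2)
    = (\<Sum>m. a m * stage_payoff g q k \<sigma>1 \<sigma>2 m)"
proof -
  obtain B where B: "B \<ge> 0" "\<And>s i j. \<bar>g s i j\<bar> \<le> B" using payoff_bounded by blast
  define G where "G z = (case z of (s, i, j) \<Rightarrow> g s i j)" for z
  have G: "\<bar>G z\<bar> \<le> B" for z using B(2) by (simp add: G_def case_prod_beta)
  interpret prob_space "play_measure q k \<sigma>1 \<sigma>2" by (rule prob_space_play_measure)
  have int: "integrable (play_measure q k \<sigma>1 \<sigma>2) (\<lambda>\<omega>. G (\<omega> m))" for m
    by (rule integrable_const_bound[where B = B]) (auto simp: G intro: measurable_play_measure)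
  have bd: "summable (\<lambda>m. \<bar>a m\<bar> * B)" using a by (rule summable_mult2)
  have "(\<integral>\<omega>. (\<Sum>m. a m * G (\<omega> m)) \<partial>play_measure q k \<sigma>1 \<sigma>2)
     = (\<Sum>m. \<integral>\<omega>. a m * G (\<omega> m) \<partial>play_measure q k \<sigma>1 \<sigma>2)"
  proof (rule integral_suminf)
    show "integrable (play_measure q k \<sigma>1 \<sigma>2) (\<lambda>\<omega>. a m * G (\<omega> m))" for m
      using int by simp
    show "AE \<omega> in play_measure q k \<sigma>1 \<sigma>2. summable (\<lambda>m. norm (a m * G (\<omega> m)))"
      by (intro AE_I2 summable_comparison_test'[OF bd, of 0]) (auto simp: abs_mult intro!: mult_left_mono G)
    have "norm (\<integral>\<omega>. norm (a m * G (\<omega> m)) \<partial>play_measure q k \<sigma>1 \<sigma>2) \<le> \<bar>a m\<bar> * B" for m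
    proof -
      have "(\<integral>\<omega>. norm (a m * G (\<omega> m)) \<partial>play_measure q k \<sigma>1 \<sigma>2) \<le> (\<integral>\<omega>. \<bar>a m\<bar> * B \<partial>play_measure q k \<sigma>1 \<sigma>2)"
        using int[of m] by (intro integral_mono) (auto simp: abs_mult intro!: mult_left_mono G)
      then show ?thesis by (simp add: prob_space)
    qed
    then show "summable (\<lambda>m. \<integral>\<omega>. norm (a m * G (\<omega> m)) \<partial>play_measure q k \<sigma>1 \<sigma>2)"
      by (intro summable_comparison_test'[OF bd, of 0])
  qed
  also have "\<dots> = (\<Sum>m. a m * stage_payoff g q k \<sigma>1 \<sigma>2 m)"
    by (simp add: expectation_play_measure stage_payoff_def G_def)
  finally show ?thesis by (simp add: G_def)
qed

lemma summable_discount: "0 < lam \<Longrightarrow> lam \<le> 1 \<Longrightarrow> summable (\<lambda>m. \<bar>lam * (1 - lam) ^ m\<bar>)" for lam :: real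
  by (simp add: abs_mult power_abs summable_mult)

lemma discounted_payoff_sums:
  fixes g :: "'k::finite \<Rightarrow> 'i::finite \<Rightarrow> 'j::finite \<Rightarrow> real"
  assumes "0 < lam" "lam \<le> 1"
  shows "(\<lambda>m. lam * (1 - lam) ^ m * stage_payoff g q k \<sigma>1 \<sigma>2 m) sums discounted_payoff g q lam k \<sigma>1 \<sigma>2"
proof -
  obtain B where B: "B \<ge> 0" "\<And>s i j. \<bar>g s i j\<bar> \<le> B" using payoff_bounded by blast
  have "summable (\<lambda>m. lam * (1 - lam) ^ m * stage_payoff g q k \<sigma>1 \<sigma>2 m)"
    by (rule summable_comparison_test'[OF summable_mult2[OF summable_discount[OF assms], of B], of 0])
      (auto simp: abs_mult power_abs B intro!: mult_left_mono stage_payoff_abs_le)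
  then show ?thesis
    unfolding discounted_payoff_def integral_weighted_payoff[OF summable_discount[OF assms]] by (rule summable_sums)
qed

lemma discounted_payoff_uminus:
  fixes g :: "'k::finite \<Rightarrow> 'i::finite \<Rightarrow> 'j::finite \<Rightarrow> real"
  assumes "0 < lam" "lam \<le> 1"
  shows "discounted_payoff (\<lambda>s i j. - g s i j) q lam k \<sigma>1 \<sigma>2 = - discounted_payoff g q lam k \<sigma>1 \<sigma>2"
proof -
  have eq: "stage_payoff (\<lambda>s i j. - g s i j) q k \<sigma>1 \<sigma>2 m = - stage_payoff g q k \<sigma>1 \<sigma>2 m" for m
    using state_expectation_linear[of q k \<sigma>1 \<sigma>2 m "-1" "\<lambda>h s. mixed (\<sigma>1 h s) (\<sigma>2 h s) (g s)" 0 "\<lambda>_ _. 0"]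
    unfolding stage_payoff_def mixed_uminus by simp
  show ?thesis
    using discounted_payoff_sums[OF assms, of "\<lambda>s i j. - g s i j" q k \<sigma>1 \<sigma>2]
      sums_minus[OF discounted_payoff_sums[OF assms, of g q k \<sigma>1 \<sigma>2]]
    by (simp add: eq sums_unique2)
qed

text \<open>Iterating the one-stage inequality \<open>n\<close> times bounds \<open>w k\<close> by
  the payoff of the first \<open>n\<close> stages plus a remainder
  \<open>(1 - lam) ^ n * W n\<close>, which vanishes because \<open>w\<close> is bounded. The
  strategies may depend on the history, so guarantees in the local games carry over to the whole
  game.\<close>

lemma discounted_payoff_ge:
  fixes g :: "'k::finite \<Rightarrow> 'i::finite \<Rightarrow> 'j::finite \<Rightarrow> real"
  assumes lam: "0 < lam" "lam \<le> 1"
    and w: "\<And>h s. w s \<le> lam * mixed (\<sigma>1 h s) (\<sigma>2 h s) (g s)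
      + (1 - lam) * mixed (\<sigma>1 h s) (\<sigma>2 h s) (transition q w s)"
  shows "w k \<le> discounted_payoff g q lam k \<sigma>1 \<sigma>2"
proof -
  let ?u = "stage_payoff g q k \<sigma>1 \<sigma>2"
  define W where "W m = state_expectation q k \<sigma>1 \<sigma>2 m (\<lambda>_. w)" for m
  have step: "W m \<le> lam * ?u m + (1 - lam) * W (Suc m)" for m
    unfolding W_def stage_payoff_def state_expectation_Suc state_expectation_linear[symmetric]
    by (rule state_expectation_mono) (rule w)
  have partial: "w k \<le> (\<Sum>m<n. lam * (1 - lam) ^ m * ?u m) + (1 - lam) ^ n * W n" for n
  proof (induction n)
    case 0
    show ?case by (simp add: W_def)
  next
    case (Suc n)
    have "(1 - lam) ^ n * W n \<le> (1 - lam) ^ n * (lam * ?u n + (1 - lam) * W (Suc n))"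
      using lam by (intro mult_left_mono step) simp
    with Suc show ?case by (simp add: algebra_simps)
  qed
  obtain B where B: "\<And>s. \<bar>w s\<bar> \<le> B"
  proof
    show "\<bar>w s\<bar> \<le> (\<Sum>s\<in>UNIV. \<bar>w s\<bar>)" for s by (rule member_le_sum) auto
  qed
  have "(\<lambda>n. (1 - lam) ^ n * W n) \<longlonglongrightarrow> 0"
  proof (rule tendsto_rabs_zero_cancel, rule tendsto_sandwich[OF _ _ tendsto_const])
    show "(\<lambda>n. (1 - lam) ^ n * B) \<longlonglongrightarrow> 0"
      using lam by (intro tendsto_mult_left_zero LIMSEQ_realpow_zero) auto
    show "\<forall>\<^sub>F n in sequentially. \<bar>(1 - lam) ^ n * W n\<bar> \<le> (1 - lam) ^ n * B"
      using lam by (auto simp: W_def abs_mult power_abs intro!: always_eventually mult_left_mono state_expectation_abs_le B)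
  qed simp
  then have "(\<lambda>n. (\<Sum>m<n. lam * (1 - lam) ^ m * ?u m) + (1 - lam) ^ n * W n) \<longlonglongrightarrow> discounted_payoff g q lam k \<sigma>1 \<sigma>2 + 0"
    by (intro tendsto_add) (use discounted_payoff_sums[OF lam, of g q k \<sigma>1 \<sigma>2] in \<open>simp_all add: sums_def\<close>)
  then show ?thesis
    using partial by (intro LIMSEQ_le_const) auto
qed

text \<open>The lower bound applied to the payoff \<open>- g\<close> and the function
  \<open>- w\<close>.\<close>

lemma discounted_payoff_le:
  fixes g :: "'k::finite \<Rightarrow> 'i::finite \<Rightarrow> 'j::finite \<Rightarrow> real"
  assumes lam: "0 < lam" "lam \<le> 1"
    and w: "\<And>h s. lam * mixed (\<sigma>1 h s) (\<sigma>2 h s) (g s)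
      + (1 - lam) * mixed (\<sigma>1 h s) (\<sigma>2 h s) (transition q w s) \<le> w s"
  shows "discounted_payoff g q lam k \<sigma>1 \<sigma>2 \<le> w k"
proof -
  have "- w k \<le> discounted_payoff (\<lambda>s i j. - g s i j) q lam k \<sigma>1 \<sigma>2"
  proof (rule discounted_payoff_ge[OF lam, of "\<lambda>s. - w s"])
    show "- w s \<le> lam * mixed (\<sigma>1 h s) (\<sigma>2 h s) (\<lambda>i j. - g s i j)
      + (1 - lam) * mixed (\<sigma>1 h s) (\<sigma>2 h s) (transition q (\<lambda>s. - w s) s)" for h s
      using w[of h s] by (simp add: mixed_uminus transition_uminus)
  qed
  then show ?thesis by (simp add: discounted_payoff_uminus[OF lam])
qed

section \<open>Stationary strategies\<close>

definition act :: "('k::finite \<Rightarrow> 'k \<Rightarrow> real) \<Rightarrow> ('k \<Rightarrow> real) \<Rightarrow> 'k \<Rightarrow> real" where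
  "act K f s = (\<Sum>s'\<in>UNIV. K s s' * f s')"

definition stochastic :: "('k::finite \<Rightarrow> 'k \<Rightarrow> real) \<Rightarrow> bool" where
  "stochastic K \<longleftrightarrow> (\<forall>s s'. 0 \<le> K s s') \<and> (\<forall>s. (\<Sum>s'\<in>UNIV. K s s') = 1)"

lemma act_abs_le:
  assumes "stochastic K" "\<And>s. \<bar>f s\<bar> \<le> c"
  shows "\<bar>act K f s\<bar> \<le> c"
proof -
  have "\<bar>act K f s\<bar> \<le> (\<Sum>s'\<in>UNIV. \<bar>K s s' * f s'\<bar>)" unfolding act_def by (rule sum_abs)
  also have "\<dots> \<le> (\<Sum>s'\<in>UNIV. K s s' * c)"
    using assms by (intro sum_mono) (auto simp: stochastic_def abs_mult intro!: mult_left_mono)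
  also have "\<dots> = c" using assms by (simp add: stochastic_def flip: sum_distrib_right)
  finally show ?thesis .
qed

lemma act_pow_abs_le:
  assumes "stochastic K" "\<And>s. \<bar>f s\<bar> \<le> c"
  shows "\<bar>(act K ^^ m) f s\<bar> \<le> c"
  by (induction m arbitrary: s) (use assms in \<open>auto intro: act_abs_le\<close>)

lemma act_linear: "act K (\<lambda>s. a * f s + b * f' s) s = a * act K f s + b * act K f' s"
  unfolding act_def by (simp add: sum.distrib distrib_left mult.left_commute flip: sum_distrib_left)

text \<open>At a state where \<open>\<bar>f\<bar>\<close> is maximal, averaging cannot exceed the
  maximum \<open>M\<close>, which leaves \<open>mu * M \<le> c\<close>. In operator terms, the
  inverse of \<open>1 - (1 - mu) K\<close> has norm at most \<open>1 / mu\<close>; both the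
  invertibility and the perturbation arguments rest on this.\<close>

lemma resolvent_bound:
  assumes K: "stochastic K" and mu: "0 < mu" "mu \<le> (1::real)"
    and b: "\<And>s. \<bar>f s - (1 - mu) * act K f s\<bar> \<le> c"
  shows "\<bar>f s\<bar> \<le> c / mu"
proof -
  define M where "M = Max (range (\<lambda>s. \<bar>f s\<bar>))"
  have M: "\<bar>f s\<bar> \<le> M" for s unfolding M_def by (rule Max_ge) auto
  have "M \<in> range (\<lambda>s. \<bar>f s\<bar>)" unfolding M_def by (rule Max_in) auto
  then obtain s0 where s0: "M = \<bar>f s0\<bar>" by blast
  have "M \<le> c + \<bar>(1 - mu) * act K f s0\<bar>"
    using b[of s0] unfolding s0 by linarith
  also have "\<dots> = c + (1 - mu) * \<bar>act K f s0\<bar>" using mu by (simp add: abs_mult)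
  also have "(1 - mu) * \<bar>act K f s0\<bar> \<le> (1 - mu) * M"
    using mu by (intro mult_left_mono act_abs_le K M) auto
  finally have "mu * M \<le> c" by (simp add: algebra_simps)
  then have "M \<le> c / mu" using mu by (simp add: field_simps)
  with M[of s] show ?thesis by simp
qed

definition stationary_kernel ::
  "('k::finite \<Rightarrow> 'i::finite \<Rightarrow> 'j::finite \<Rightarrow> 'k pmf) \<Rightarrow> ('k \<Rightarrow> 'i pmf) \<Rightarrow> ('k \<Rightarrow> 'j pmf) \<Rightarrow> 'k \<Rightarrow> 'k \<Rightarrow> real" where
  "stationary_kernel q x y s s' = mixed (x s) (y s) (\<lambda>i j. pmf (q s i j) s')"

definition reward ::
  "('k::finite \<Rightarrow> 'i::finite \<Rightarrow> 'j::finite \<Rightarrow> real) \<Rightarrow> ('k \<Rightarrow> 'i pmf) \<Rightarrow> ('k \<Rightarrow> 'j pmf) \<Rightarrow> 'k \<Rightarrow> real" where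
  "reward g x y s = mixed (x s) (y s) (g s)"

lemma act_stationary_kernel: "act (stationary_kernel q x y) f s = mixed (x s) (y s) (transition q f s)"
  unfolding act_def stationary_kernel_def transition_def[abs_def] by (simp add: mixed_sum)

lemma stochastic_stationary_kernel: "stochastic (stationary_kernel q x y)"
proof -
  have "(\<Sum>s'\<in>UNIV. stationary_kernel q x y s s') = 1" for s
    using act_stationary_kernel[of q x y "\<lambda>_. 1" s] by (simp add: act_def transition_def[abs_def] sum_pmf_eq_1)
  moreover have "0 \<le> stationary_kernel q x y s s'" for s s'
    unfolding stationary_kernel_def mixed_def by (intro sum_nonneg) simp
  ultimately show ?thesis by (simp add: stochastic_def)
qed

abbreviation stationary_payoff where
  "stationary_payoff g q lam x y k \<equiv> discounted_payoff g q lam k (stationary x) (stationary y)"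

text \<open>Under stationary strategies the states form a Markov chain with matrix
  \<open>stationary_kernel q x y\<close>.\<close>

lemma state_expectation_stationary:
  "state_expectation q k (stationary x) (stationary y) m (\<lambda>_. f) = (act (stationary_kernel q x y) ^^ m) f k"
proof (induction m arbitrary: f)
  case (Suc m)
  have "state_expectation q k (stationary x) (stationary y) (Suc m) (\<lambda>_. f)
    = state_expectation q k (stationary x) (stationary y) m (\<lambda>_. act (stationary_kernel q x y) f)"
    by (simp add: state_expectation_Suc act_stationary_kernel[abs_def] stationary_def)
  then show ?case by (simp add: Suc funpow_swap1)
qed simp

lemma stage_payoff_stationary:
  "stage_payoff g q k (stationary x) (stationary y) m = (act (stationary_kernel q x y) ^^ m) (reward g x y) k"
  unfolding state_expectation_stationary[symmetric] stage_payoff_def by (simp add: reward_def[abs_def] stationary_def)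

text \<open>Splitting off the first term of the discounted series; the rest is the series of the
  next state, averaged by the kernel and scaled by \<open>1 - lam\<close>.\<close>

lemma stationary_payoff_eq:
  assumes "0 < lam" "lam \<le> 1"
  shows "stationary_payoff g q lam x y k = lam * reward g x y k
    + (1 - lam) * act (stationary_kernel q x y) (stationary_payoff g q lam x y) k"
proof -
  let ?K = "stationary_kernel q x y" and ?r = "reward g x y" and ?v = "stationary_payoff g q lam x y"
  have sums: "(\<lambda>m. lam * (1 - lam) ^ m * (act ?K ^^ m) ?r k) sums ?v k" for k
    using discounted_payoff_sums[OF assms, of g q k "stationary x" "stationary y"] by (simp add: stage_payoff_stationary)
  have "(\<lambda>m. \<Sum>s\<in>UNIV. ?K k s * (lam * (1 - lam) ^ m * (act ?K ^^ m) ?r s)) sums act ?K ?v k"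
    unfolding act_def[of ?K ?v] by (intro sums_sum sums_mult sums)
  then have "(\<lambda>m. (1 - lam) * (lam * (1 - lam) ^ m * (act ?K ^^ Suc m) ?r k)) sums ((1 - lam) * act ?K ?v k)"
    by (intro sums_mult) (simp add: act_def mult_ac sum_distrib_left)
  then have "(\<lambda>m. lam * (1 - lam) ^ Suc m * (act ?K ^^ Suc m) ?r k) sums ((1 - lam) * act ?K ?v k)"
    by (simp add: mult_ac)
  then have "(\<lambda>m. lam * (1 - lam) ^ m * (act ?K ^^ m) ?r k) sums ((1 - lam) * act ?K ?v k + lam * ?r k)"
    by (subst (asm) sums_Suc_iff) (simp add: algebra_simps)
  with sums[of k] show ?thesis using sums_unique2 by fastforce
qed

section \<open>Shapley's theorem\<close>

text \<open>Some action in the support of \<open>p\<close> earns at most the average \<open>v\<close>, and the fixed point equation then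
  forces the total excess to vanish.\<close>

lemma nash_fixpoint:
  fixes p e :: "'a::finite \<Rightarrow> real"
  assumes p: "\<And>i. 0 \<le> p i" "(\<Sum>i\<in>UNIV. p i) = 1" and v: "v = (\<Sum>i\<in>UNIV. p i * e i)"
    and fix_pt: "\<And>i. p i = (p i + max 0 (e i - v)) / (1 + (\<Sum>i\<in>UNIV. max 0 (e i - v)))"
  shows "e i \<le> v"
proof -
  define T where "T = (\<Sum>i\<in>UNIV. max 0 (e i - v))"
  have T: "T \<ge> 0" unfolding T_def by (intro sum_nonneg) simp
  have eq: "p i * T = max 0 (e i - v)" for i
    using fix_pt[of i] T unfolding T_def[symmetric] by (simp add: field_simps)
  have "\<exists>i. p i > 0 \<and> e i \<le> v"
  proof (rule ccontr)
    assume "\<not> ?thesis"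
    then have c: "p i > 0 \<Longrightarrow> e i > v" for i by force
    obtain i0 where "p i0 > 0"
      using p by (metis less_eq_real_def sum.neutral zero_neq_one)
    then have "(\<Sum>i\<in>UNIV. p i * v) < (\<Sum>i\<in>UNIV. p i * e i)"
    proof (intro sum_strict_mono_ex1)
      show "\<forall>i\<in>UNIV. p i * v \<le> p i * e i"
        using c p(1) by (metis less_eq_real_def mult_left_mono mult_zero_left)
    qed (use c \<open>p i0 > 0\<close> in \<open>auto intro!: exI[of _ i0]\<close>)
    then show False using p(2) v by (simp flip: sum_distrib_right)
  qed
  then obtain i0 where "p i0 > 0" "e i0 \<le> v" by blast
  with eq[of i0] have "T = 0" by auto
  with eq[of i] show ?thesis by simp
qed

lemma pmf_of_weights:
  fixes f :: "'a::finite \<Rightarrow> real"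
  assumes "\<And>i. 0 \<le> f i" "(\<Sum>i\<in>UNIV. f i) = 1"
  obtains p where "pmf p = f"
proof
  show "pmf (embed_pmf f) = f"
    by (rule ext, rule pmf_embed_pmf)
      (use assms in \<open>auto simp: nn_integral_count_space_finite sum_ennreal\<close>)
qed

lemma weights_of_pmf: "(\<Sum>i\<in>UNIV. pmf (p::'a::finite pmf) i) = 1"
  by (rule sum_pmf_eq_1) auto

section \<open>Shapley's auxiliary one-shot games with continuation payoff \<open>w\<close>\<close>

definition local_game ::
  "('k::finite \<Rightarrow> 'i::finite \<Rightarrow> 'j::finite \<Rightarrow> real) \<Rightarrow> ('k \<Rightarrow> 'i \<Rightarrow> 'j \<Rightarrow> 'k pmf) \<Rightarrow> real
    \<Rightarrow> ('k \<Rightarrow> real) \<Rightarrow> 'k \<Rightarrow> 'i \<Rightarrow> 'j \<Rightarrow> real" where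
  "local_game g q lam w s i j = lam * g s i j + (1 - lam) * transition q w s i j"

lemma mixed_local_game:
  "mixed p1 p2 (local_game g q lam w s) = lam * mixed p1 p2 (g s) + (1 - lam) * mixed p1 p2 (transition q w s)"
  unfolding local_game_def[abs_def] by (rule mixed_linear)

lemma transition_abs_le:
  assumes "\<And>s. \<bar>w s\<bar> \<le> B"
  shows "\<bar>transition q w s i j\<bar> \<le> B"
proof -
  have "\<bar>transition q w s i j\<bar> \<le> (\<Sum>s'\<in>UNIV. \<bar>pmf (q s i j) s' * w s'\<bar>)"
    unfolding transition_def by (rule sum_abs)
  also have "\<dots> \<le> (\<Sum>s'\<in>UNIV. pmf (q s i j) s' * B)"
    using assms by (intro sum_mono) (auto simp: abs_mult intro!: mult_left_mono)
  also have "\<dots> = B" by (simp add: weights_of_pmf flip: sum_distrib_right)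
  finally show ?thesis .
qed

lemma local_game_abs_le:
  assumes "0 < lam" "lam \<le> 1" "\<And>s i j. \<bar>g s i j\<bar> \<le> B" "\<And>s. \<bar>w s\<bar> \<le> B"
  shows "\<bar>local_game g q lam w s i j\<bar> \<le> B"
proof -
  have "\<bar>local_game g q lam w s i j\<bar> \<le> lam * \<bar>g s i j\<bar> + (1 - lam) * \<bar>transition q w s i j\<bar>"
    unfolding local_game_def using assms(1,2) by (metis abs_mult abs_of_nonneg abs_triangle_ineq diff_ge_0_iff_ge less_imp_le)
  also have "\<dots> \<le> lam * B + (1 - lam) * B"
    using assms by (intro add_mono mult_left_mono transition_abs_le) auto
  finally show ?thesis by (simp add: algebra_simps)
qed

text \<open>A product of simplices, one for each state, placed in a Euclidean space so that
  Brouwer's theorem applies.\<close>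

definition weight_vectors :: "(real ^ ('k::finite \<times> 'a::finite)) set" where
  "weight_vectors = {x. (\<forall>s a. 0 \<le> x $ (s, a)) \<and> (\<forall>s. (\<Sum>a\<in>UNIV. x $ (s, a)) = 1)}"

lemma convex_weight_vectors: "convex weight_vectors"
  unfolding convex_def weight_vectors_def
  by (auto simp: sum.distrib simp flip: sum_distrib_left)

lemma compact_weight_vectors: "compact (weight_vectors :: (real ^ ('k::finite \<times> 'a::finite)) set)"
proof (rule compact_eq_bounded_closed[THEN iffD2], intro conjI)
  have "(weight_vectors :: (real ^ ('k \<times> 'a)) set) \<subseteq> cbox 0 1"
  proof
    fix x :: "real ^ ('k \<times> 'a)" assume x: "x \<in> weight_vectors"
    have "x $ (s, a) \<le> 1" for s a
    proof -
      have "x $ (s, a) \<le> (\<Sum>a\<in>UNIV. x $ (s, a))"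
        by (rule member_le_sum) (use x in \<open>auto simp: weight_vectors_def\<close>)
      then show ?thesis using x by (simp add: weight_vectors_def)
    qed
    then show "x \<in> cbox 0 1" using x by (auto simp: mem_box_cart weight_vectors_def)
  qed
  then show "bounded (weight_vectors :: (real ^ ('k \<times> 'a)) set)"
    using bounded_cbox bounded_subset by blast
  show "closed (weight_vectors :: (real ^ ('k \<times> 'a)) set)"
    unfolding weight_vectors_def
    by (intro closed_Collect_conj closed_Collect_all closed_Collect_le closed_Collect_eq continuous_intros)
qed

lemma weight_vectors_nonempty: "weight_vectors \<noteq> ({} :: (real ^ ('k::finite \<times> 'a::finite)) set)"
proof -
  have "(\<chi> p. 1 / real CARD('a)) \<in> (weight_vectors :: (real ^ ('k \<times> 'a)) set)"
    by (simp add: weight_vectors_def)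
  then show ?thesis by blast
qed

text \<open>Solving for \<open>w\<close>, \<open>x\<close> and \<open>y\<close> simultaneously lets
  one fixed point do the work of both the minimax theorem and the contraction argument: its first
  coordinate makes \<open>w\<close> the payoff of the local games it defines, and its other
  coordinates leave no profitable pure deviation.\<close>

theorem shapley_equilibrium:
  fixes g :: "'k::finite \<Rightarrow> 'i::finite \<Rightarrow> 'j::finite \<Rightarrow> real"
  assumes lam: "0 < lam" "lam \<le> 1"
  obtains w x y where
    "\<And>s p. mixed p (y s) (local_game g q lam w s) \<le> w s"
    "\<And>s p. w s \<le> mixed (x s) p (local_game g q lam w s)"
proof -
  obtain B where B: "B \<ge> 0" "\<And>s i j. \<bar>g s i j\<bar> \<le> B" using payoff_bounded by blast
  \<comment> \<open>The radius \<open>B\<close> bounds the stage payoffs, and a local payoff is a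
    convex combination of a stage payoff and an average of \<open>w\<close>, so the box is mapped
    into itself.\<close>
  define S where "S = (cbox (\<chi> s. - B) (\<chi> s. B) :: (real ^ 'k) set) \<times>
    ((weight_vectors :: (real ^ ('k \<times> 'i)) set) \<times> (weight_vectors :: (real ^ ('k \<times> 'j)) set))"
  define A where "A z s i j = local_game g q lam (\<lambda>s. fst z $ s) s i j"
    for z :: "(real ^ 'k) \<times> (real ^ ('k \<times> 'i)) \<times> (real ^ ('k \<times> 'j))" and s i j
  define X where "X z s i = fst (snd z) $ (s, i)"
    for z :: "(real ^ 'k) \<times> (real ^ ('k \<times> 'i)) \<times> (real ^ ('k \<times> 'j))" and s i
  define Y where "Y z s j = snd (snd z) $ (s, j)"
    for z :: "(real ^ 'k) \<times> (real ^ ('k \<times> 'i)) \<times> (real ^ ('k \<times> 'j))" and s j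
  define V where "V z s = (\<Sum>i\<in>UNIV. \<Sum>j\<in>UNIV. X z s i * Y z s j * A z s i j)" for z s
  define e1 where "e1 z s i = (\<Sum>j\<in>UNIV. Y z s j * A z s i j)" for z s i
  \<comment> \<open>Player 2 receives \<open>- A\<close>; with this sign Player 2 also maximizes,
    and \<open>nash_fixpoint\<close> applies with \<open>- V\<close> as the average.\<close>
  define e2 where "e2 z s j = - (\<Sum>i\<in>UNIV. X z s i * A z s i j)" for z s j
  define F where "F z = ((\<chi> s. V z s),
     (\<chi> p. (X z (fst p) (snd p) + max 0 (e1 z (fst p) (snd p) - V z (fst p)))
        / (1 + (\<Sum>i\<in>UNIV. max 0 (e1 z (fst p) i - V z (fst p))))),
     (\<chi> p. (Y z (fst p) (snd p) + max 0 (e2 z (fst p) (snd p) - (- V z (fst p))))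
        / (1 + (\<Sum>j\<in>UNIV. max 0 (e2 z (fst p) j - (- V z (fst p)))))))" for z
  have pos1: "1 + (\<Sum>i\<in>UNIV. max 0 (f i)) > (0::real)" for f :: "'i \<Rightarrow> real"
    by (intro add_pos_nonneg sum_nonneg) auto
  have pos2: "1 + (\<Sum>i\<in>UNIV. max 0 (f i)) > (0::real)" for f :: "'j \<Rightarrow> real"
    by (intro add_pos_nonneg sum_nonneg) auto
  have contF: "continuous_on S F"
    unfolding F_def V_def e1_def e2_def A_def X_def Y_def local_game_def transition_def
    by (intro continuous_intros ballI) (use pos1 pos2 in \<open>auto simp: less_imp_neq[symmetric]\<close>)
  \<comment> \<open>Back from vectors to \<open>pmf\<close>, so that the bounds on
    \<open>mixed\<close> can be reused.\<close>
  have pm: "\<exists>p1 p2. \<forall>s. pmf (p1 s) = X z s \<and> pmf (p2 s) = Y z s" if "z \<in> S" for z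
  proof -
    have "\<exists>p. pmf p = X z s" for s
      by (rule pmf_of_weights[of "X z s"]) (use that in \<open>auto simp: S_def X_def weight_vectors_def\<close>)
    moreover have "\<exists>p. pmf p = Y z s" for s
      by (rule pmf_of_weights[of "Y z s"]) (use that in \<open>auto simp: S_def Y_def weight_vectors_def\<close>)
    ultimately show ?thesis by metis
  qed
  have "F z \<in> S" if z: "z \<in> S" for z
  proof -
    obtain p1 p2 where p: "\<And>s. pmf (p1 s) = X z s" "\<And>s. pmf (p2 s) = Y z s" using pm[OF z] by blast
    have "\<bar>V z s\<bar> \<le> B" for s
    proof -
      have w: "\<bar>fst z $ s\<bar> \<le> B" for s
        using z by (auto simp: S_def mem_box_cart abs_le_iff minus_le_iff)
      have "V z s = mixed (p1 s) (p2 s) (A z s)" by (simp add: V_def mixed_def p)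
      then show ?thesis
        unfolding A_def by (simp only:) (intro mixed_abs_le local_game_abs_le lam B(2) w)
    qed
    then have "(\<chi> s. V z s) \<in> cbox (\<chi> s. - B) (\<chi> s. B)"
      by (auto simp: mem_box_cart abs_le_iff minus_le_iff)
    moreover have "0 \<le> X z s i" "0 \<le> Y z s j" "(\<Sum>i\<in>UNIV. X z s i) = 1" "(\<Sum>j\<in>UNIV. Y z s j) = 1" for s i j
      using weights_of_pmf[of "p1 s"] weights_of_pmf[of "p2 s"] by (simp_all add: p flip: p)
    ultimately show ?thesis
      using pos1 pos2 unfolding F_def S_def
      by (auto simp: weight_vectors_def sum.distrib less_imp_neq[symmetric] simp flip: sum_divide_distrib
          intro!: divide_nonneg_pos add_nonneg_nonneg)
  qed
  then have "F ` S \<subseteq> S" by blast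
  moreover have "compact S" "convex S" "S \<noteq> {}"
    unfolding S_def using B(1)
    by (auto intro!: compact_Times compact_weight_vectors convex_Times convex_weight_vectors
        simp: weight_vectors_nonempty interval_ne_empty_cart)
  ultimately obtain z where z: "z \<in> S" "F z = z"
    using brouwer[OF _ _ _ contF] by blast
  obtain p1 p2 where p: "\<And>s. pmf (p1 s) = X z s" "\<And>s. pmf (p2 s) = Y z s" using pm[OF z(1)] by blast
  have w: "V z s = fst z $ s" for s
    using arg_cong[OF z(2), of "\<lambda>z. fst z $ s"] by (simp add: F_def)
  have f1: "X z s i = (X z s i + max 0 (e1 z s i - V z s)) / (1 + (\<Sum>i\<in>UNIV. max 0 (e1 z s i - V z s)))" for s i
    using arg_cong[OF z(2), of "\<lambda>z. X z s i"] by (simp add: F_def X_def)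
  have f2: "Y z s j = (Y z s j + max 0 (e2 z s j - (- V z s))) / (1 + (\<Sum>j\<in>UNIV. max 0 (e2 z s j - (- V z s))))" for s j
    using arg_cong[OF z(2), of "\<lambda>z. Y z s j"] by (simp add: F_def Y_def)
  have n: "0 \<le> X z s i" "0 \<le> Y z s j" "(\<Sum>i\<in>UNIV. X z s i) = 1" "(\<Sum>j\<in>UNIV. Y z s j) = 1" for s i j
    using weights_of_pmf[of "p1 s"] weights_of_pmf[of "p2 s"] by (simp_all add: p flip: p)
  have le1: "e1 z s i \<le> V z s" for s i
  proof (rule nash_fixpoint[OF n(1) n(3) _ f1])
    show "V z s = (\<Sum>i\<in>UNIV. X z s i * e1 z s i)"
      by (simp add: V_def e1_def sum_distrib_left mult.assoc)
  qed
  have le2: "e2 z s j \<le> - V z s" for s j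
  proof (rule nash_fixpoint[OF n(2) n(4) _ f2])
    have "V z s = (\<Sum>j\<in>UNIV. \<Sum>i\<in>UNIV. X z s i * Y z s j * A z s i j)"
      unfolding V_def by (rule sum.swap)
    then show "- V z s = (\<Sum>j\<in>UNIV. Y z s j * e2 z s j)"
      by (simp add: e2_def sum_distrib_left sum_negf mult_ac)
  qed
  define w where "w s = fst z $ s" for s
  have A: "A z s = local_game g q lam w s" for s
  proof -
    have "w = ($) (fst z)" by (simp add: w_def fun_eq_iff)
    then show ?thesis by (intro ext) (simp only: A_def)
  qed
  have "mixed p (p2 s) (local_game g q lam w s) \<le> w s" for s p
  proof -
    have "mixed p (p2 s) (A z s) = (\<Sum>i\<in>UNIV. pmf p i * e1 z s i)"
      by (simp add: mixed_def \<open>\<And>s. pmf (p2 s) = Y z s\<close> e1_def sum_distrib_left mult.assoc)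
    also have "\<dots> \<le> (\<Sum>i\<in>UNIV. pmf p i * V z s)"
      by (intro sum_mono mult_left_mono le1) simp
    also have "\<dots> = w s" by (simp add: weights_of_pmf w w_def flip: sum_distrib_right)
    finally show ?thesis by (simp add: A)
  qed
  moreover have "w s \<le> mixed (p1 s) p (local_game g q lam w s)" for s p
  proof -
    have "w s = (\<Sum>j\<in>UNIV. pmf p j * V z s)" by (simp add: weights_of_pmf w w_def flip: sum_distrib_right)
    also have "\<dots> \<le> (\<Sum>j\<in>UNIV. pmf p j * (- e2 z s j))"
      by (intro sum_mono mult_left_mono) (use le2 in \<open>auto simp: le_minus_iff minus_le_iff\<close>)
    also have "\<dots> = (\<Sum>j\<in>UNIV. \<Sum>i\<in>UNIV. X z s i * pmf p j * A z s i j)"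
      by (simp add: e2_def sum_distrib_left mult_ac)
    also have "\<dots> = mixed (p1 s) p (A z s)"
      unfolding mixed_def by (subst sum.swap) (simp add: \<open>\<And>s. pmf (p1 s) = X z s\<close>)
    finally show ?thesis by (simp add: A)
  qed
  ultimately show thesis by (rule that)
qed

section \<open>From the fixed point to the value and to optimal strategies\<close>

lemma discounted_payoff_abs_le:
  fixes g :: "'k::finite \<Rightarrow> 'i::finite \<Rightarrow> 'j::finite \<Rightarrow> real"
  assumes lam: "0 < lam" "lam \<le> 1" and B: "\<And>s i j. \<bar>g s i j\<bar> \<le> B"
  shows "\<bar>discounted_payoff g q lam k \<sigma>1 \<sigma>2\<bar> \<le> B"
proof -
  have b: "mixed p1 p2 (g s) \<le> B" "- B \<le> mixed p1 p2 (g s)" for p1 p2 s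
    using mixed_abs_le[of "g s" B p1 p2] B by (auto simp: abs_le_iff)
  have c: "transition q (\<lambda>_. c) s = (\<lambda>_ _. c)" for c s
    by (simp add: transition_def fun_eq_iff weights_of_pmf flip: sum_distrib_right)
  have l: "lam * a + (1 - lam) * b \<le> b \<longleftrightarrow> a \<le> b" "b \<le> lam * a + (1 - lam) * b \<longleftrightarrow> b \<le> a" for a b
    using lam(1) by (auto simp: algebra_simps)
  \<comment> \<open>The constants \<open>B\<close> and \<open>- B\<close> satisfy the one-stage
    inequalities, since \<open>transition\<close> preserves constants.\<close>
  have "discounted_payoff g q lam k \<sigma>1 \<sigma>2 \<le> B"
    by (rule discounted_payoff_le[OF lam, where w = "\<lambda>_. B"]) (simp add: c l b)
  moreover have "- B \<le> discounted_payoff g q lam k \<sigma>1 \<sigma>2"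
    by (rule discounted_payoff_ge[OF lam, where w = "\<lambda>_. - B"]) (simp only: c l b mixed_const)
  ultimately show ?thesis by (simp add: abs_le_iff)
qed

text \<open>The stationary strategies \<open>x\<close> and \<open>y\<close> of
  \<open>shapley_equilibrium\<close> guarantee \<open>w k\<close> against every strategy, so both
  sides equal \<open>w k\<close>. The bounds \<open>bb\<close> and \<open>ba\<close> come first
  because a real supremum or infimum is meaningful only on a bounded set.\<close>

theorem value_exists:
  fixes g :: "'k::finite \<Rightarrow> 'i::finite \<Rightarrow> 'j::finite \<Rightarrow> real"
  assumes lam: "0 < lam" "lam \<le> 1"
  shows "max_min g q lam k = min_max g q lam k"
proof -
  obtain w x y where wy: "\<And>s p. mixed p (y s) (local_game g q lam w s) \<le> w s"
    and wx: "\<And>s p. w s \<le> mixed (x s) p (local_game g q lam w s)"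
    using shapley_equilibrium[OF lam] by metis
  let ?d = "discounted_payoff g q lam k"
  have y: "?d \<sigma>1 (stationary y) \<le> w k" for \<sigma>1
    by (rule discounted_payoff_le[OF lam, where w = w]) (use wy in \<open>simp add: stationary_def mixed_local_game\<close>)
  have x: "w k \<le> ?d (stationary x) \<sigma>2" for \<sigma>2
    by (rule discounted_payoff_ge[OF lam, where w = w]) (use wx in \<open>simp add: stationary_def mixed_local_game\<close>)
  obtain B where "B \<ge> 0" and "\<And>s i j. \<bar>g s i j\<bar> \<le> B" using payoff_bounded by blast
  from this(2) have b: "?d \<sigma>1 \<sigma>2 \<le> B" "- B \<le> ?d \<sigma>1 \<sigma>2" for \<sigma>1 \<sigma>2
    using discounted_payoff_abs_le[OF lam, of g B q k \<sigma>1 \<sigma>2] by (auto simp: abs_le_iff)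
  have bb: "bdd_below (range (?d \<sigma>1))" for \<sigma>1 using b(2) by (auto intro!: bdd_belowI[of _ "- B"])
  have ba: "bdd_above (range (\<lambda>\<sigma>1. ?d \<sigma>1 \<sigma>2))" for \<sigma>2 using b(1) by (auto intro!: bdd_aboveI[of _ B])
  have i: "(INF \<sigma>2. ?d \<sigma>1 \<sigma>2) \<le> w k" for \<sigma>1
    by (rule cINF_lower2[where x = "stationary y", OF bb UNIV_I]) (rule y)
  have s: "w k \<le> (SUP \<sigma>1. ?d \<sigma>1 \<sigma>2)" for \<sigma>2
    by (rule cSUP_upper2[where x = "stationary x", OF ba UNIV_I]) (rule x)
  have "max_min g q lam k = w k"
    unfolding max_min_def
  proof (rule antisym)
    show "(SUP \<sigma>1. INF \<sigma>2. ?d \<sigma>1 \<sigma>2) \<le> w k" by (rule cSUP_least) (use i in auto)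
    have "w k \<le> (INF \<sigma>2. ?d (stationary x) \<sigma>2)" by (rule cINF_greatest) (use x in auto)
    then show "w k \<le> (SUP \<sigma>1. INF \<sigma>2. ?d \<sigma>1 \<sigma>2)"
      by (intro cSUP_upper2[where x = "stationary x"]) (use i in \<open>auto intro!: bdd_aboveI[of _ "w k"]\<close>)
  qed
  moreover have "min_max g q lam k = w k"
    unfolding min_max_def
  proof (rule antisym)
    show "w k \<le> (INF \<sigma>2. SUP \<sigma>1. ?d \<sigma>1 \<sigma>2)" by (rule cINF_greatest) (use s in auto)
    have "(SUP \<sigma>1. ?d \<sigma>1 (stationary y)) \<le> w k" by (rule cSUP_least) (use y in auto)
    then show "(INF \<sigma>2. SUP \<sigma>1. ?d \<sigma>1 \<sigma>2) \<le> w k"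
      by (intro cINF_lower2[where x = "stationary y"]) (use s in \<open>auto intro!: bdd_belowI[of _ "w k"]\<close>)
  qed
  ultimately show ?thesis by simp
qed

lemma optimal1_ge:
  fixes g :: "'k::finite \<Rightarrow> 'i::finite \<Rightarrow> 'j::finite \<Rightarrow> real"
  assumes lam: "0 < lam" "lam \<le> 1" and opt: "optimal1 g q lam \<sigma>1"
  shows "discounted_value g q lam k \<le> discounted_payoff g q lam k \<sigma>1 \<sigma>2"
proof -
  obtain B where "B \<ge> 0" and "\<And>s i j. \<bar>g s i j\<bar> \<le> B" using payoff_bounded by blast
  from this(2) have "- B \<le> discounted_payoff g q lam k \<sigma>1 \<sigma>2" for \<sigma>2
    using discounted_payoff_abs_le[OF lam, of g B q k \<sigma>1 \<sigma>2] by (auto simp: abs_le_iff)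
  then have "bdd_below (range (discounted_payoff g q lam k \<sigma>1))" by (auto intro!: bdd_belowI[of _ "- B"])
  then have "(INF \<sigma>2. discounted_payoff g q lam k \<sigma>1 \<sigma>2) \<le> discounted_payoff g q lam k \<sigma>1 \<sigma>2"
    by (rule cINF_lower) simp
  then show ?thesis using opt by (simp add: optimal1_def discounted_value_def)
qed

text \<open>Optimality of Player 2 refers to the min-max, whereas \<open>discounted_value\<close> is
  the max-min; Shapley's theorem bridges the two.\<close>

lemma optimal2_le:
  fixes g :: "'k::finite \<Rightarrow> 'i::finite \<Rightarrow> 'j::finite \<Rightarrow> real"
  assumes lam: "0 < lam" "lam \<le> 1" and opt: "optimal2 g q lam \<sigma>2"
  shows "discounted_payoff g q lam k \<sigma>1 \<sigma>2 \<le> discounted_value g q lam k"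
proof -
  obtain B where "B \<ge> 0" and "\<And>s i j. \<bar>g s i j\<bar> \<le> B" using payoff_bounded by blast
  from this(2) have "discounted_payoff g q lam k \<sigma>1 \<sigma>2 \<le> B" for \<sigma>1
    using discounted_payoff_abs_le[OF lam, of g B q k \<sigma>1 \<sigma>2] by (auto simp: abs_le_iff)
  then have "bdd_above (range (\<lambda>\<sigma>1. discounted_payoff g q lam k \<sigma>1 \<sigma>2))" by (auto intro!: bdd_aboveI[of _ B])
  then have "discounted_payoff g q lam k \<sigma>1 \<sigma>2 \<le> (SUP \<sigma>1. discounted_payoff g q lam k \<sigma>1 \<sigma>2)"
    by (intro cSUP_upper) simp
  then show ?thesis using opt value_exists[OF lam, of g q k] by (simp add: optimal2_def discounted_value_def)
qed

section \<open>Quotients of power series at zero\<close>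

text \<open>Germs at \<open>0\<close> from the right of meromorphic functions. Poles are allowed
  because Puiseux series may start at a negative exponent and Cramer's rule divides; only positive
  \<open>s\<close> matters, as \<open>s\<close> stands for a root of the discount rate.\<close>

definition quotient_germ :: "(real \<Rightarrow> real) \<Rightarrow> bool" where
  "quotient_germ f \<longleftrightarrow> (\<exists>a b A B. a has_fps_expansion A \<and> b has_fps_expansion B \<and> B \<noteq> 0 \<and>
     (\<forall>\<^sub>F s in at_right 0. f s = a s / b s))"

text \<open>Dividing by \<open>s ^ subdegree F\<close> leaves a function whose limit at
  \<open>0\<close> is the leading coefficient.\<close>

lemma has_fps_expansion_eventually_nonzero:
  fixes f :: "real \<Rightarrow> real"
  assumes "f has_fps_expansion F" "F \<noteq> 0"
  shows "\<forall>\<^sub>F s in at_right 0. f s \<noteq> 0"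
proof -
  let ?n = "subdegree F"
  let ?g = "\<lambda>s. if s = 0 then fps_nth F ?n else f s / s ^ ?n"
  have "?g has_fps_expansion fps_shift ?n F"
    by (rule has_fps_expansion_shift) (use assms in auto)
  then have "continuous (at 0 within {0<..}) ?g" by (rule has_fps_expansion_imp_continuous)
  then have "(?g \<longlongrightarrow> fps_nth F ?n) (at_right 0)"
    by (simp add: continuous_within)
  moreover have "fps_nth F ?n \<noteq> 0" using assms by simp
  ultimately have "\<forall>\<^sub>F s in at_right 0. ?g s \<noteq> 0"
    by (rule tendsto_imp_eventually_ne)
  then show ?thesis
    using eventually_at_right_less[of "0::real"] by eventually_elim (auto split: if_splits)
qed

lemma quotient_germ_has_fps_expansion: "f has_fps_expansion F \<Longrightarrow> quotient_germ f"
  unfolding quotient_germ_def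
  by (rule exI[of _ f], rule exI[of _ "\<lambda>_. 1"], rule exI[of _ F], rule exI[of _ 1]) simp

lemma quotient_germ_const [simp]: "quotient_germ (\<lambda>_. c)"
  by (rule quotient_germ_has_fps_expansion) (rule has_fps_expansion_const)

lemma quotient_germ_power [simp]: "quotient_germ (\<lambda>s. s ^ n)"
  by (rule quotient_germ_has_fps_expansion) (rule has_fps_expansion_fps_X_power)

lemma quotient_germ_cong:
  assumes "quotient_germ f" "\<forall>\<^sub>F s in at_right 0. f' s = f s"
  shows "quotient_germ f'"
proof -
  obtain a b A B where "a has_fps_expansion A" "b has_fps_expansion B" "B \<noteq> 0"
    and e: "\<forall>\<^sub>F s in at_right 0. f s = a s / b s"
    using assms(1) unfolding quotient_germ_def by blast
  moreover have "\<forall>\<^sub>F s in at_right 0. f' s = a s / b s"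
    using assms(2) e by eventually_elim simp
  ultimately show ?thesis unfolding quotient_germ_def by blast
qed

lemma quotient_germ_add:
  assumes "quotient_germ f" "quotient_germ h"
  shows "quotient_germ (\<lambda>s. f s + h s)"
proof -
  obtain a b A B where 1: "a has_fps_expansion A" "b has_fps_expansion B" "B \<noteq> 0"
    and e: "\<forall>\<^sub>F s in at_right 0. f s = a s / b s"
    using assms(1) unfolding quotient_germ_def by blast
  obtain c d C D where 2: "c has_fps_expansion C" "d has_fps_expansion D" "D \<noteq> 0"
    and e': "\<forall>\<^sub>F s in at_right 0. h s = c s / d s"
    using assms(2) unfolding quotient_germ_def by blast
  have "\<forall>\<^sub>F s in at_right 0. f s + h s = (a s * d s + c s * b s) / (b s * d s)"
    using e e' has_fps_expansion_eventually_nonzero[OF 1(2,3)] has_fps_expansion_eventually_nonzero[OF 2(2,3)]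
    by eventually_elim (simp add: field_simps)
  moreover have "(\<lambda>s. a s * d s + c s * b s) has_fps_expansion A * D + C * B"
    "(\<lambda>s. b s * d s) has_fps_expansion B * D"
    using 1 2 by (auto intro!: fps_expansion_intros)
  moreover have "B * D \<noteq> 0" using 1 2 by simp
  ultimately show ?thesis unfolding quotient_germ_def by blast
qed

lemma quotient_germ_mult:
  assumes "quotient_germ f" "quotient_germ h"
  shows "quotient_germ (\<lambda>s. f s * h s)"
proof -
  obtain a b A B where 1: "a has_fps_expansion A" "b has_fps_expansion B" "B \<noteq> 0"
    and e: "\<forall>\<^sub>F s in at_right 0. f s = a s / b s"
    using assms(1) unfolding quotient_germ_def by blast
  obtain c d C D where 2: "c has_fps_expansion C" "d has_fps_expansion D" "D \<noteq> 0"
    and e': "\<forall>\<^sub>F s in at_right 0. h s = c s / d s"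
    using assms(2) unfolding quotient_germ_def by blast
  have "\<forall>\<^sub>F s in at_right 0. f s * h s = (a s * c s) / (b s * d s)"
    using e e' by eventually_elim simp
  moreover have "(\<lambda>s. a s * c s) has_fps_expansion A * C" "(\<lambda>s. b s * d s) has_fps_expansion B * D"
    using 1 2 by (auto intro!: fps_expansion_intros)
  moreover have "B * D \<noteq> 0" using 1 2 by simp
  ultimately show ?thesis unfolding quotient_germ_def by blast
qed

lemma quotient_germ_diff:
  assumes "quotient_germ f" "quotient_germ h"
  shows "quotient_germ (\<lambda>s. f s - h s)"
  using quotient_germ_add[OF assms(1) quotient_germ_mult[OF quotient_germ_const[of "-1"] assms(2)]] by simp

lemma quotient_germ_inverse:
  assumes "quotient_germ f"
  shows "quotient_germ (\<lambda>s. inverse (f s))"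
proof -
  obtain a b A B where 1: "a has_fps_expansion A" "b has_fps_expansion B" "B \<noteq> 0"
    and e: "\<forall>\<^sub>F s in at_right 0. f s = a s / b s"
    using assms(1) unfolding quotient_germ_def by blast
  show ?thesis
  proof (cases "A = 0")
    \<comment> \<open>Here \<open>f\<close> vanishes near \<open>0\<close>, and so does its inverse
      by the convention \<open>inverse 0 = 0\<close>.\<close>
    case True
    have "\<forall>\<^sub>F s in nhds 0. eval_fps A s = a s" using 1(1) by (simp add: has_fps_expansion_def)
    then have "\<forall>\<^sub>F s in at_right 0. eval_fps A s = a s"
      by (simp add: eventually_at_filter eventually_mono)
    then have "\<forall>\<^sub>F s in at_right 0. inverse (f s) = 0"
      using e by eventually_elim (simp add: True)
    then show ?thesis by (rule quotient_germ_cong[rotated]) simp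
  next
    case False
    have "\<forall>\<^sub>F s in at_right 0. inverse (f s) = b s / a s"
      using e by eventually_elim simp
    with 1 False show ?thesis unfolding quotient_germ_def by blast
  qed
qed

lemma quotient_germ_divide:
  assumes "quotient_germ f" "quotient_germ h"
  shows "quotient_germ (\<lambda>s. f s / h s)"
  using quotient_germ_mult[OF assms(1) quotient_germ_inverse[OF assms(2)]] by (simp add: divide_inverse)

lemma quotient_germ_sum:
  "(\<And>i. i \<in> A \<Longrightarrow> quotient_germ (f i)) \<Longrightarrow> quotient_germ (\<lambda>s. \<Sum>i\<in>A. f i s)"
  by (induction A rule: infinite_finite_induct) (auto intro: quotient_germ_add)

lemma quotient_germ_prod:
  "(\<And>i. i \<in> A \<Longrightarrow> quotient_germ (f i)) \<Longrightarrow> quotient_germ (\<lambda>s. \<Prod>i\<in>A. f i s)"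
  by (induction A rule: infinite_finite_induct) (auto intro: quotient_germ_mult)

lemma quotient_germ_det:
  assumes "\<And>i j. quotient_germ (\<lambda>s. M s $ i $ j)"
  shows "quotient_germ (\<lambda>s. det (M s :: real ^ 'n ^ 'n))"
  unfolding det_def
  by (intro quotient_germ_sum quotient_germ_mult quotient_germ_const quotient_germ_prod assms)

text \<open>A bounded quotient has no pole, so the subdegree of the denominator is at most that of
  the numerator, or the numerator is zero, and the quotient is again a power series.\<close>

lemma quotient_germ_bounded:
  assumes "quotient_germ f" and bd: "\<forall>\<^sub>F s in at_right 0. \<bar>f s\<bar> \<le> B"
  obtains h H where "h has_fps_expansion H" "\<forall>\<^sub>F s in at_right 0. f s = h s"
proof -
  obtain a b A B' where 1: "a has_fps_expansion A" "b has_fps_expansion B'" "B' \<noteq> 0"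
    and e: "\<forall>\<^sub>F s in at_right 0. f s = a s / b s"
    using assms(1) unfolding quotient_germ_def by blast
  show thesis
  proof (cases "A = 0 \<or> subdegree B' \<le> subdegree A")
    case True
    show ?thesis
    proof (cases "A = 0")
      case True
      have "\<forall>\<^sub>F s in nhds 0. eval_fps A s = a s" using 1(1) by (simp add: has_fps_expansion_def)
      then have "\<forall>\<^sub>F s in at_right 0. eval_fps A s = a s"
        by (simp add: eventually_at_filter eventually_mono)
      then have "\<forall>\<^sub>F s in at_right 0. f s = 0"
        using e by eventually_elim (simp add: True)
      then show ?thesis by (intro that[of "\<lambda>_. 0" 0]) auto
    next
      case False
      with True have "subdegree B' \<le> subdegree A" by blast
      from has_fps_expansion_divide[OF 1(1,2) this 1(3) refl]
      show ?thesis
      proof (rule that)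
        show "\<forall>\<^sub>F s in at_right 0. f s = (if s = 0 then fps_nth A (subdegree B') / fps_nth B' (subdegree B') else a s / b s)"
          using e eventually_at_right_less[of "0::real"] by eventually_elim simp
      qed
    qed
  next
    case False
    then have A: "A \<noteq> 0" "subdegree A < subdegree B'" by auto
    let ?c = "fps_nth B' (subdegree A) / fps_nth A (subdegree A)"
    have c: "?c = 0" using A nth_less_subdegree_zero[of "subdegree A" B'] by simp
    have "(\<lambda>x. if x = 0 then ?c else b x / a x) has_fps_expansion B' / A"
      by (rule has_fps_expansion_divide) (use 1 A in auto)
    then have "continuous (at 0 within {0<..}) (\<lambda>x. if x = 0 then ?c else b x / a x)"
      by (rule has_fps_expansion_imp_continuous)
    then have "((\<lambda>x. if x = 0 then ?c else b x / a x) \<longlongrightarrow> 0) (at_right 0)"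
      by (simp add: continuous_within c)
    \<comment> \<open>In the case of a pole, \<open>b x / a x\<close> tends to \<open>0\<close>,
      while \<open>\<bar>a x / b x\<bar> \<le> B\<close> keeps it away from \<open>0\<close>. The
      \<open>+ 1\<close> makes the threshold positive and strictly smaller than what the bound
      permits.\<close>
    then have "\<forall>\<^sub>F x in at_right 0. \<bar>if x = 0 then ?c else b x / a x\<bar> < 1 / (\<bar>B\<bar> + 1)"
      by (intro order_tendstoD(2)[OF tendsto_rabs_zero]) auto
    then have "\<forall>\<^sub>F x::real in at_right 0. False"
      using bd e has_fps_expansion_eventually_nonzero[OF 1(2,3)] has_fps_expansion_eventually_nonzero[OF 1(1) A(1)]
        eventually_at_right_less[of "0::real"]
    proof eventually_elim
      case (elim x)
      then have "\<bar>b x\<bar> * (\<bar>B\<bar> + 1) < \<bar>a x\<bar>" by (simp add: field_simps)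
      moreover have "\<bar>a x\<bar> \<le> \<bar>B\<bar> * \<bar>b x\<bar>" using elim by (simp add: field_simps)
      ultimately show False by (simp add: algebra_simps)
    qed
    then show ?thesis by simp
  qed
qed

section \<open>Power series near zero and the substitution of a root of the discount rate\<close>

lemma has_fps_expansion_real_differentiable:
  fixes h :: "real \<Rightarrow> real"
  assumes "h has_fps_expansion H"
  shows "\<forall>\<^sub>F s in nhds 0. (h has_real_derivative deriv h s) (at s)"
    "(h \<longlongrightarrow> h 0) (at_right 0)" "((\<lambda>s. s * deriv h s) \<longlongrightarrow> 0) (at_right 0)"
proof -
  from assms obtain X where X: "open X" "0 \<in> X" "\<And>s. s \<in> X \<Longrightarrow> eval_fps H s = h s"
    and r: "fps_conv_radius H > 0"
    unfolding has_fps_expansion_def eventually_nhds by blast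
  have X': "open (X \<inter> eball 0 (fps_conv_radius H))" "0 \<in> X \<inter> eball 0 (fps_conv_radius H)"
    using X r by (auto simp: zero_ereal_def)
  have "(h has_real_derivative deriv h s) (at s)" if s: "s \<in> X \<inter> eball 0 (fps_conv_radius H)" for s
  proof -
    have "(eval_fps H has_field_derivative eval_fps (fps_deriv H) s) (at s)"
      by (rule has_field_derivative_eval_fps) (use s in auto)
    then have "(h has_field_derivative eval_fps (fps_deriv H) s) (at s)"
      by (rule has_field_derivative_transform_within_open[OF _ X'(1) s]) (use X(3) in auto)
    then show ?thesis using DERIV_imp_deriv by metis
  qed
  then show "\<forall>\<^sub>F s in nhds 0. (h has_real_derivative deriv h s) (at s)"
    using X' unfolding eventually_nhds by blast
  show "(h \<longlongrightarrow> h 0) (at_right 0)"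
    using has_fps_expansion_imp_continuous[OF assms, of "{0<..}"] by (simp add: continuous_within)
  have "(deriv h \<longlongrightarrow> deriv h 0) (at_right 0)"
    using has_fps_expansion_imp_continuous[OF has_fps_expansion_deriv[OF assms], of "{0<..}"]
    by (simp add: continuous_within)
  then have "((\<lambda>s. s * deriv h s) \<longlongrightarrow> 0 * deriv h 0) (at_right 0)"
    by (intro tendsto_mult tendsto_ident_at)
  then show "((\<lambda>s. s * deriv h s) \<longlongrightarrow> 0) (at_right 0)" by simp
qed

text \<open>The coefficients move to the multiples of \<open>d\<close>. This lets Puiseux series
  with different denominators be written in one common root.\<close>

lemma has_fps_expansion_compose_power:
  fixes h :: "real \<Rightarrow> real"
  assumes "h has_fps_expansion H" "d \<ge> 1"
  shows "(\<lambda>s. h (s ^ d)) has_fps_expansion Abs_fps (\<lambda>n. if d dvd n then fps_nth H (n div d) else 0)"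
proof (rule has_fps_expansionI)
  have r: "0 < fps_conv_radius H" and e: "\<forall>\<^sub>F s in nhds 0. eval_fps H s = h s"
    using assms(1) by (simp_all add: has_fps_expansion_def)
  have "((\<lambda>s::real. s ^ d) \<longlongrightarrow> 0 ^ d) (nhds 0)" by (intro tendsto_power tendsto_ident_at filterlim_ident)
  then have lim: "filterlim (\<lambda>s::real. s ^ d) (nhds 0) (nhds 0)" using assms(2) by (simp add: power_0_left)
  have "\<forall>\<^sub>F s in nhds 0. s \<in> eball (0::real) (fps_conv_radius H)"
    by (rule eventually_nhds_in_open) (use r in \<open>auto simp: zero_ereal_def\<close>)
  with e have "\<forall>\<^sub>F s in nhds 0. eval_fps H s = h s \<and> s \<in> eball 0 (fps_conv_radius H)"
    by (rule eventually_conj)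
  from eventually_compose_filterlim[OF this lim]
  show "\<forall>\<^sub>F s in nhds 0. (\<lambda>n. fps_nth (Abs_fps (\<lambda>n. if d dvd n then fps_nth H (n div d) else 0)) n * s ^ n) sums h (s ^ d)"
  proof eventually_elim
    case (elim s)
    have "(\<lambda>n. fps_nth H n * (s ^ d) ^ n) sums h (s ^ d)"
      using sums_eval_fps[of "s ^ d" H] elim by auto
    then have "(\<lambda>n. (\<lambda>n. (if d dvd n then fps_nth H (n div d) else 0) * s ^ n) (d * n)) sums h (s ^ d)"
      using assms(2) by (simp add: power_mult)
    moreover have "strict_mono (\<lambda>n. d * n)" using assms(2) by (auto simp: strict_mono_def)
    ultimately show ?case by (subst (asm) sums_mono_reindex) auto
  qed
qed

text \<open>With \<open>lam = s ^ N\<close> the series becomes \<open>s\<close> to the integer power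
  \<open>m0\<close> times an ordinary power series in \<open>s\<close>. All multiples of
  \<open>N\<close> are covered, so that a common root can be chosen later.\<close>

lemma puiseux_on_quotient_germ:
  assumes "puiseux_on lam0 f" "lam0 > 0"
  obtains N where "N \<ge> 1" "\<And>n. N dvd n \<Longrightarrow> n \<ge> 1 \<Longrightarrow> quotient_germ (\<lambda>s. f (s ^ n))"
proof -
  obtain m0 :: int and N :: nat and c where N: "N \<ge> 1"
    and f: "\<And>lam. lam \<in> {0<..<lam0} \<Longrightarrow>
      (\<lambda>n. c (m0 + int n) * lam powr (real_of_int (m0 + int n) / real N)) sums f lam"
    using assms(1) unfolding puiseux_on_def by blast
  define F where "F = Abs_fps (\<lambda>n. c (m0 + int n))"
  have f': "(\<lambda>n. fps_nth F n * s ^ n) sums (s powr (- real_of_int m0) * f (s ^ N))"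
    if s: "0 < s" "s ^ N < lam0" for s :: real
  proof -
    have "(\<lambda>n. c (m0 + int n) * (s ^ N) powr (real_of_int (m0 + int n) / real N)) sums f (s ^ N)"
      by (rule f) (use s in auto)
    then have "(\<lambda>n. s powr (- real_of_int m0) * (c (m0 + int n) * (s ^ N) powr (real_of_int (m0 + int n) / real N)))
      sums (s powr (- real_of_int m0) * f (s ^ N))"
      by (rule sums_mult)
    moreover have "s powr (- real_of_int m0) * (c (m0 + int n) * (s ^ N) powr (real_of_int (m0 + int n) / real N))
      = fps_nth F n * s ^ n" for n
    proof -
      have "(s ^ N) powr (real_of_int (m0 + int n) / real N) = s powr (real_of_int m0 + real n)"
        using s N by (simp add: powr_powr flip: powr_realpow)
      also have "s powr (- real_of_int m0) * \<dots> = s ^ n"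
        using s by (simp add: powr_realpow flip: powr_add)
      finally show ?thesis by (simp add: F_def mult_ac)
    qed
    ultimately show ?thesis by simp
  qed
  obtain s0 where s0: "0 < s0" "s0 ^ N < lam0"
  \<comment> \<open>Capping at \<open>1\<close> makes the \<open>N\<close>-th power at most the
    number itself, hence below \<open>lam0\<close>.\<close>
  proof (rule that[of "min 1 (lam0 / 2)"])
    show "0 < min 1 (lam0 / 2)" using assms(2) by simp
    have "min 1 (lam0 / 2) ^ N \<le> min 1 (lam0 / 2) ^ 1"
      by (rule power_decreasing) (use N assms(2) in auto)
    then show "min 1 (lam0 / 2) ^ N < lam0" using assms(2) by simp
  qed
  \<comment> \<open>Convergence at the single point \<open>s0 > 0\<close> already gives a positive
    radius of convergence.\<close>
  have "summable (\<lambda>n. fps_nth F n * s0 ^ n)" using f'[OF s0] by (simp add: sums_iff)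
  then have "fps_conv_radius F \<ge> norm s0"
    unfolding fps_conv_radius_def by (rule conv_radius_geI)
  then have F0: "fps_conv_radius F > 0"
    using s0(1) by (metis ereal_less(2) less_le_trans norm_zero zero_less_norm_iff less_irrefl)
  have FF: "eval_fps F has_fps_expansion F" using F0 by (rule eval_fps_has_fps_expansion)
  show thesis
  proof (rule that[OF N])
    fix n assume "N dvd n" "n \<ge> (1::nat)"
    then obtain d where d: "n = N * d" "d \<ge> 1" by (auto elim!: dvdE)
    have q: "quotient_germ (\<lambda>s. eval_fps F (s ^ d))"
      using has_fps_expansion_compose_power[OF FF d(2)] by (rule quotient_germ_has_fps_expansion)
    have q': "quotient_germ (\<lambda>s. (s ^ d) powi m0)"
    proof (cases "m0 \<ge> 0")
      case True
      then show ?thesis by (simp add: power_int_def flip: power_mult)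
    next
      case False
      then show ?thesis
        using quotient_germ_inverse[OF quotient_germ_power]
        by (simp add: power_int_def flip: power_mult power_inverse)
    qed
    have "\<forall>\<^sub>F s in at_right 0. s < min s0 1"
      using s0(1) by (intro eventually_at_rightI[of 0 "min s0 1"]) auto
    then have "\<forall>\<^sub>F s in at_right 0. f (s ^ n) = (s ^ d) powi m0 * eval_fps F (s ^ d)"
      using eventually_at_right_less[of "0::real"]
    proof eventually_elim
      case (elim s)
      have "s ^ d \<le> s ^ 1" by (rule power_decreasing) (use elim d in auto)
      then have "s ^ d \<le> s0" using elim by simp
      then have "(s ^ d) ^ N \<le> s0 ^ N" by (rule power_mono) (use elim in auto)
      then have "(s ^ d) ^ N < lam0" using s0 by simp
      from f'[OF _ this] elim have "eval_fps F (s ^ d) = (s ^ d) powr (- real_of_int m0) * f ((s ^ d) ^ N)"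
        by (simp add: eval_fps_def sums_iff)
      then have "(s ^ d) powi m0 * eval_fps F (s ^ d) = ((s ^ d) powr (real_of_int m0) * (s ^ d) powr (- real_of_int m0)) * f ((s ^ d) ^ N)"
        using elim by (simp add: powr_real_of_int')
      also have "\<dots> = f ((s ^ d) ^ N)" using elim by (simp flip: powr_add)
      finally show ?case by (simp add: d(1) power_mult[symmetric] mult.commute)
    qed
    then show "quotient_germ (\<lambda>s. f (s ^ n))"
      by (rule quotient_germ_cong[OF quotient_germ_mult[OF q' q]])
  qed
qed

section \<open>The envelope formula\<close>

text \<open>Boundedness makes \<open>f (s ^ N)\<close> a power series \<open>h\<close> in
  \<open>s\<close>, so \<open>f lam = h (p lam)\<close> with \<open>p\<close> the
  \<open>N\<close>-th root. The derivative may blow up like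
  \<open>lam powr (1 / real N - 1)\<close>, but \<open>lam * f' lam\<close> is
  \<open>s * deriv h s / N\<close> at \<open>s = p lam\<close>.\<close>

lemma bounded_germ_asymptotics:
  assumes germ: "quotient_germ (\<lambda>s. f (s ^ N))" and N: "N \<ge> 1" and bd: "\<forall>\<^sub>F s in at_right 0. \<bar>f (s ^ N)\<bar> \<le> B"
  obtains L f' where "(f \<longlongrightarrow> L) (at_right 0)"
    "\<forall>\<^sub>F lam in at_right 0. (f has_real_derivative f' lam) (at lam)"
    "((\<lambda>lam. lam * f' lam) \<longlongrightarrow> 0) (at_right 0)"
proof -
  obtain h H where h: "h has_fps_expansion H" and fh: "\<forall>\<^sub>F s in at_right 0. f (s ^ N) = h s"
    using quotient_germ_bounded[OF germ bd] by blast
  note hd = has_fps_expansion_real_differentiable[OF h]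
  have "\<forall>\<^sub>F s in at_right 0. (h has_real_derivative deriv h s) (at s)"
    using hd(1) by (simp add: eventually_at_filter eventually_mono)
  with fh have "\<forall>\<^sub>F s in at_right 0. f (s ^ N) = h s \<and> (h has_real_derivative deriv h s) (at s)"
    by (rule eventually_conj)
  then obtain e where e: "e > 0" "\<And>s. 0 < s \<Longrightarrow> s < e \<Longrightarrow> f (s ^ N) = h s"
    "\<And>s. 0 < s \<Longrightarrow> s < e \<Longrightarrow> (h has_real_derivative deriv h s) (at s)"
    by (auto simp: eventually_at_right_field)
  define p where "p lam = lam powr (1 / real N)" for lam :: real
  have p0: "p lam > 0" if "lam > 0" for lam using that by (simp add: p_def)
  have pN: "p lam ^ N = lam" if "lam > 0" for lam
    using that N by (simp add: p_def powr_powr flip: powr_realpow)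
  have pe: "p lam < e" if "0 < lam" "lam < e ^ N" for lam
  proof -
    have "p lam ^ N < e ^ N" using that by (simp add: pN)
    then show ?thesis using e(1) power_less_imp_less_base by fastforce
  qed
  have "(p \<longlongrightarrow> 0) (at_right 0)"
    unfolding p_def
    by (rule tendsto_zero_powrI[of "\<lambda>x. x" _ "\<lambda>_. 1 / real N" "1 / real N"])
      (use N in \<open>auto simp: eventually_at_right_less less_imp_le intro: eventually_mono[OF eventually_at_right_less]\<close>)
  then have plim: "filterlim p (at_right 0) (at_right 0)"
    by (simp add: filterlim_at) (rule eventually_mono[OF eventually_at_right_less], use p0 in force)
  have small: "\<forall>\<^sub>F lam in at_right 0. 0 < lam \<and> lam < e ^ N"
    by (rule eventually_at_rightI[of 0 "e ^ N"]) (use e(1) in auto)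
  have fp: "f lam = h (p lam)" if "0 < lam" "lam < e ^ N" for lam
    using e(2)[OF p0 pe] that by (simp add: pN)
  define f' where "f' lam = deriv h (p lam) * (1 / real N * lam powr (1 / real N - 1))" for lam
  show thesis
  proof (rule that)
    have "((\<lambda>lam. h (p lam)) \<longlongrightarrow> h 0) (at_right 0)"
      by (rule filterlim_compose[OF hd(2) plim])
    then show "(f \<longlongrightarrow> h 0) (at_right 0)"
      by (rule Lim_transform_eventually) (use small fp in \<open>auto elim: eventually_mono\<close>)
    show "\<forall>\<^sub>F lam in at_right 0. (f has_real_derivative f' lam) (at lam)"
      using small
    proof eventually_elim
      case (elim lam)
      have "(p has_real_derivative 1 / real N * lam powr (1 / real N - 1)) (at lam)"
        unfolding p_def by (rule has_real_derivative_powr) (use elim in simp)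
      then have "((\<lambda>lam. h (p lam)) has_real_derivative f' lam) (at lam)"
        unfolding f'_def by (rule DERIV_chain2[rotated]) (use elim e(3)[OF p0 pe] in auto)
      then show ?case
        by (rule has_field_derivative_transform_within_open[of _ _ _ "{0<..<e ^ N}"]) (use elim fp in auto)
    qed
    have "((\<lambda>lam. 1 / real N * (p lam * deriv h (p lam))) \<longlongrightarrow> 1 / real N * 0) (at_right 0)"
      by (intro tendsto_mult tendsto_const filterlim_compose[OF hd(3) plim])
    then have "((\<lambda>lam. 1 / real N * (p lam * deriv h (p lam))) \<longlongrightarrow> 0) (at_right 0)" by simp
    then show "((\<lambda>lam. lam * f' lam) \<longlongrightarrow> 0) (at_right 0)"
    proof (rule Lim_transform_eventually)
      show "\<forall>\<^sub>F lam in at_right 0. 1 / real N * (p lam * deriv h (p lam)) = lam * f' lam"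
        using eventually_at_right_less[of "0::real"]
      proof eventually_elim
        case (elim lam)
        have "lam * lam powr (1 / real N - 1) = p lam"
          using elim by (simp add: p_def powr_diff)
        then show ?case by (simp add: f'_def mult_ac)
      qed
    qed
  qed
qed

text \<open>Cramer's rule: each coordinate of the solution is a quotient of determinants, which are
  polynomials in the entries and hence germs of the same kind.\<close>

lemma quotient_germ_resolvent:
  fixes f :: "real \<Rightarrow> 'k::finite \<Rightarrow> real"
  assumes K: "\<And>i j. quotient_germ (\<lambda>s. K s i j)" and lam: "quotient_germ lam" and b: "\<And>i. quotient_germ (\<lambda>s. b s i)"
    and eq: "\<forall>\<^sub>F s in at_right 0. 0 < lam s \<and> lam s \<le> 1 \<and> stochastic (K s) \<and>
      (\<forall>i. f s i - (1 - lam s) * act (K s) (f s) i = b s i)"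
  shows "quotient_germ (\<lambda>s. f s k)"
proof -
  define M where "M s = (\<chi> i j. (if i = j then 1 else 0) - (1 - lam s) * K s i j :: real ^ 'k ^ 'k)" for s
  \<comment> \<open>The matrix \<open>M s\<close> with column \<open>k\<close> replaced by the
    right-hand side.\<close>
  define Mk where "Mk s = (\<chi> i j. if j = k then b s i else M s $ i $ j :: real ^ 'k ^ 'k)" for s
  have M: "quotient_germ (\<lambda>s. M s $ i $ j)" for i j
    unfolding M_def by (simp only: vec_lambda_beta)
      (intro quotient_germ_diff quotient_germ_mult quotient_germ_const K lam)
  have Mk: "quotient_germ (\<lambda>s. Mk s $ i $ j)" for i j
    unfolding Mk_def by (cases "j = k") (auto intro: b M)
  have Mv: "(M s *v x) $ i = x $ i - (1 - lam s) * act (K s) (\<lambda>j. x $ j) i" for s x i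
  proof -
    have "(M s *v x) $ i = (\<Sum>j\<in>UNIV. (if i = j then x $ j else 0) - (1 - lam s) * (K s i j * x $ j))"
      unfolding matrix_vector_mult_def M_def by (auto intro!: sum.cong simp: algebra_simps)
    then show ?thesis
      by (simp add: sum_subtractf act_def flip: sum_distrib_left)
  qed
  have "\<forall>\<^sub>F s in at_right 0. f s k = det (Mk s) / det (M s)"
    using eq
  proof eventually_elim
    case (elim s)
    have mv: "M s *v (\<chi> j. f s j) = (\<chi> i. b s i)"
      using elim by (simp add: vec_eq_iff Mv)
    then have "det (Mk s) = f s k * det (M s)"
      using cramer_lemma[of k "M s" "\<chi> j. f s j", unfolded mv vec_lambda_beta] by (simp add: Mk_def)
    moreover have "det (M s) \<noteq> 0"
    proof
      assume "det (M s) = 0"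
      \<comment> \<open>A kernel vector solves the homogeneous resolvent equation, and
        \<open>resolvent_bound\<close> with \<open>c = 0\<close> forces it to be zero.\<close>
      then obtain x where x: "x \<noteq> 0" "M s *v x = 0"
        using invertible_det_nz[of "M s"] matrix_left_invertible_ker[of "M s"]
        by (auto simp: invertible_left_inverse)
      have "x $ i - (1 - lam s) * act (K s) (\<lambda>j. x $ j) i = 0" for i
        using x(2) Mv[of s x i] by simp
      note r = this
      have "\<bar>x $ i\<bar> \<le> 0 / lam s" for i
      proof (rule resolvent_bound)
        show "\<bar>x $ i - (1 - lam s) * act (K s) (\<lambda>j. x $ j) i\<bar> \<le> 0" for i
          unfolding r by simp
      qed (use elim in auto)
      then show False using x(1) by (simp add: vec_eq_iff)
    qed
    ultimately show ?case by simp
  qed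
  then show ?thesis
    by (rule quotient_germ_cong[rotated]) (intro quotient_germ_divide quotient_germ_det M Mk)
qed

section \<open>Perturbation of the resolvent equation\<close>

lemma tendsto_act:
  assumes "\<And>s s'. ((\<lambda>a. K a s s') \<longlongrightarrow> K0 s s') F" "\<And>s. ((\<lambda>a. f a s) \<longlongrightarrow> f0 s) F"
  shows "((\<lambda>a. act (K a) (f a) s) \<longlongrightarrow> act K0 f0 s) F"
  unfolding act_def by (intro tendsto_sum tendsto_mult assms)

text \<open>The error \<open>f a - f0\<close> solves a resolvent equation whose right-hand side
  tends to \<open>0\<close>; since \<open>mu\<close> tends to \<open>mu0 > 0\<close>, the factor
  \<open>1 / mu\<close> in \<open>resolvent_bound\<close> stays bounded.\<close>

lemma tendsto_resolvent:
  fixes K :: "'a \<Rightarrow> 'k::finite \<Rightarrow> 'k \<Rightarrow> real"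
  assumes K: "\<And>s s'. ((\<lambda>a. K a s s') \<longlongrightarrow> K0 s s') F" and stoch: "\<And>a. stochastic (K a)"
    and mu: "(mu \<longlongrightarrow> mu0) F" "mu0 > 0" "\<forall>\<^sub>F a in F. 0 < mu a \<and> mu a \<le> 1"
    and b: "\<And>s. (b s \<longlongrightarrow> f0 s - (1 - mu0) * act K0 f0 s) F"
    and eq: "\<forall>\<^sub>F a in F. \<forall>s. f a s - (1 - mu a) * act (K a) (f a) s = b s a"
  shows "((\<lambda>a. f a s) \<longlongrightarrow> f0 s) F"
proof -
  \<comment> \<open>The residual of \<open>f0\<close> in the equation with index
    \<open>a\<close>.\<close>
  define r where "r a s = b s a - (f0 s - (1 - mu a) * act (K a) f0 s)" for a s
  have "((\<lambda>a. r a s) \<longlongrightarrow> (f0 s - (1 - mu0) * act K0 f0 s) - (f0 s - (1 - mu0) * act K0 f0 s)) F" for s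
    unfolding r_def by (intro tendsto_intros b mu tendsto_act K)
  then have "((\<lambda>a. r a s) \<longlongrightarrow> 0) F" for s by simp
  then have "((\<lambda>a. (\<Sum>s\<in>UNIV. \<bar>r a s\<bar>) / mu a) \<longlongrightarrow> (\<Sum>s\<in>(UNIV::'k set). \<bar>0\<bar>) / mu0) F"
    using mu(2) by (intro tendsto_intros mu) auto
  then have lim: "((\<lambda>a. (\<Sum>s\<in>UNIV. \<bar>r a s\<bar>) / mu a) \<longlongrightarrow> 0) F" by simp
  have "((\<lambda>a. f a s - f0 s) \<longlongrightarrow> 0) F"
  proof (rule Lim_null_comparison[OF _ lim])
    show "\<forall>\<^sub>F a in F. norm (f a s - f0 s) \<le> (\<Sum>s\<in>UNIV. \<bar>r a s\<bar>) / mu a"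
      using eq mu(3)
    proof eventually_elim
      case (elim a)
      have "(f a s - f0 s) - (1 - mu a) * act (K a) (\<lambda>s. f a s - f0 s) s = r a s" for s
      proof -
        have "act (K a) (\<lambda>s. f a s - f0 s) s = act (K a) (f a) s - act (K a) f0 s"
          using act_linear[of "K a" 1 "f a" "-1" f0 s] by simp
        moreover have "f a s - (1 - mu a) * act (K a) (f a) s = b s a" using elim by blast
        ultimately show ?thesis by (simp add: r_def right_diff_distrib)
      qed
      moreover have "\<bar>r a s\<bar> \<le> (\<Sum>s\<in>UNIV. \<bar>r a s\<bar>)" for s by (rule member_le_sum) auto
      ultimately have "\<bar>f a s - f0 s\<bar> \<le> (\<Sum>s\<in>UNIV. \<bar>r a s\<bar>) / mu a"
        using elim by (intro resolvent_bound[OF stoch[of a], of "mu a" "\<lambda>s. f a s - f0 s"]) auto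
      then show ?case by simp
    qed
  qed
  then show ?thesis by (simp add: LIM_zero_iff)
qed

text \<open>The solution is the discounted payoff of an auxiliary game whose stage payoff is \<open>b / lam\<close>.\<close>

lemma resolvent_solvable:
  fixes q :: "'k::finite \<Rightarrow> 'i::finite \<Rightarrow> 'j::finite \<Rightarrow> 'k pmf"
  assumes "0 < lam" "lam \<le> 1"
  shows "\<exists>d. \<forall>s. d s - (1 - lam) * act (stationary_kernel q x y) d s = b s"
proof (intro exI allI)
  fix s
  show "stationary_payoff (\<lambda>s i j. b s / lam) q lam x y s - (1 - lam) *
    act (stationary_kernel q x y) (stationary_payoff (\<lambda>s i j. b s / lam) q lam x y) s = b s"
    using stationary_payoff_eq[OF assms, where g = "\<lambda>s i j. b s / lam" and q = q and x = x and y = y and k = s] assms by (simp add: reward_def)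
qed

lemma tendsto_mixed:
  assumes "\<And>i. ((\<lambda>a. pmf (p1 a) i) \<longlongrightarrow> pmf p1' i) F" "\<And>j. ((\<lambda>a. pmf (p2 a) j) \<longlongrightarrow> pmf p2' j) F"
  shows "((\<lambda>a. mixed (p1 a) (p2 a) A) \<longlongrightarrow> mixed p1' p2' A) F"
  unfolding mixed_def by (intro tendsto_intros assms)

text \<open>Subtracting the payoff equations at \<open>mu\<close> and \<open>lam\<close> for the
  same strategies and dividing by \<open>mu - lam\<close> shows that the difference quotient solves
  a resolvent equation at rate \<open>mu\<close>, with right-hand side the reward minus the averaged
  payoff at rate \<open>lam\<close>. The strategies move with \<open>mu\<close> because the saddle
  point comparison below needs that for one player at a time.\<close>

lemma difference_quotient_tendsto:
  fixes g :: "'k::finite \<Rightarrow> 'i::finite \<Rightarrow> 'j::finite \<Rightarrow> real"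
  assumes lam: "0 < lam" "lam < 1"
    and X: "\<And>k i. ((\<lambda>mu. pmf (X mu k) i) \<longlongrightarrow> pmf (x k) i) (at_right lam)"
    and Y: "\<And>k j. ((\<lambda>mu. pmf (Y mu k) j) \<longlongrightarrow> pmf (y k) j) (at_right lam)"
    and d: "\<And>s. d s - (1 - lam) * act (stationary_kernel q x y) d s
      = reward g x y s - act (stationary_kernel q x y) (stationary_payoff g q lam x y) s"
  shows "((\<lambda>mu. (stationary_payoff g q mu (X mu) (Y mu) s - stationary_payoff g q lam (X mu) (Y mu) s) / (mu - lam))
    \<longlongrightarrow> d s) (at_right lam)"
proof -
  let ?K = "\<lambda>mu. stationary_kernel q (X mu) (Y mu)" and ?r = "\<lambda>mu. reward g (X mu) (Y mu)"
  let ?p = "\<lambda>mu. stationary_payoff g q lam (X mu) (Y mu)" and ?p' = "\<lambda>mu. stationary_payoff g q mu (X mu) (Y mu)"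
  have K: "((\<lambda>mu. ?K mu s s') \<longlongrightarrow> stationary_kernel q x y s s') (at_right lam)" for s s'
    unfolding stationary_kernel_def by (intro tendsto_mixed X Y)
  have r: "((\<lambda>mu. ?r mu s) \<longlongrightarrow> reward g x y s) (at_right lam)" for s
    unfolding reward_def by (intro tendsto_mixed X Y)
  have ev: "\<forall>\<^sub>F mu in at_right lam. lam < mu \<and> mu \<le> 1"
    by (rule eventually_at_rightI[of lam 1]) (use lam in auto)
  have le: "lam \<le> 1" using lam by simp
  \<comment> \<open>At the fixed rate \<open>lam\<close> the payoff is continuous in the
    strategies.\<close>
  have p: "((\<lambda>mu. ?p mu s) \<longlongrightarrow> stationary_payoff g q lam x y s) (at_right lam)" for s
  proof (rule tendsto_resolvent[OF K stochastic_stationary_kernel tendsto_const lam(1)])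
    show "((\<lambda>mu. lam * ?r mu s) \<longlongrightarrow> stationary_payoff g q lam x y s
       - (1 - lam) * act (stationary_kernel q x y) (stationary_payoff g q lam x y) s) (at_right lam)" for s
      using stationary_payoff_eq[OF lam(1) le, where g = g and q = q and x = x and y = y and k = s] by (auto intro!: tendsto_eq_intros r)
    show "\<forall>\<^sub>F mu in at_right lam. \<forall>s. ?p mu s - (1 - lam) * act (?K mu) (?p mu) s = lam * ?r mu s"
      using stationary_payoff_eq[OF lam(1) le, of g q] by (auto simp: algebra_simps)
  qed (use lam in auto)
  show ?thesis
  proof (rule tendsto_resolvent[OF K stochastic_stationary_kernel tendsto_ident_at lam(1)])
    show "\<forall>\<^sub>F a in at_right lam. 0 < a \<and> a \<le> 1" using ev lam by (auto elim: eventually_mono)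
    show "((\<lambda>mu. ?r mu s - act (?K mu) (?p mu) s) \<longlongrightarrow>
       d s - (1 - lam) * act (stationary_kernel q x y) d s) (at_right lam)" for s
      unfolding d by (intro tendsto_diff r tendsto_act K p)
    show "\<forall>\<^sub>F mu in at_right lam. \<forall>s. (?p' mu s - ?p mu s) / (mu - lam) - (1 - mu) * act (?K mu)
       (\<lambda>s. (?p' mu s - ?p mu s) / (mu - lam)) s = ?r mu s - act (?K mu) (?p mu) s"
      using ev
    proof eventually_elim
      case (elim mu)
      show ?case
      proof
        fix s
        let ?c = "1 / (mu - lam)"
        have a: "act (?K mu) (\<lambda>s. (?p' mu s - ?p mu s) / (mu - lam)) s
          = (act (?K mu) (?p' mu) s - act (?K mu) (?p mu) s) / (mu - lam)"
          using act_linear[of "?K mu" ?c "?p' mu" "- ?c" "?p mu" s] by (simp add: diff_divide_distrib)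
        have 1: "?p' mu s = mu * ?r mu s + (1 - mu) * act (?K mu) (?p' mu) s"
          using elim lam by (intro stationary_payoff_eq) auto
        have 2: "?p mu s = lam * ?r mu s + (1 - lam) * act (?K mu) (?p mu) s"
          using lam by (intro stationary_payoff_eq) auto
        have "(?p' mu s - ?p mu s) - (1 - mu) * (act (?K mu) (?p' mu) s - act (?K mu) (?p mu) s)
          = (mu - lam) * (?r mu s - act (?K mu) (?p mu) s)"
          using 1 2 by (simp add: algebra_simps)
        then have "((?p' mu s - ?p mu s) - (1 - mu) * (act (?K mu) (?p' mu) s - act (?K mu) (?p mu) s)) / (mu - lam)
          = ?r mu s - act (?K mu) (?p mu) s"
          using elim by simp
        then show "(?p' mu s - ?p mu s) / (mu - lam) - (1 - mu) * act (?K mu) (\<lambda>s. (?p' mu s - ?p mu s) / (mu - lam)) s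
          = ?r mu s - act (?K mu) (?p mu) s"
          unfolding a by (simp only: diff_divide_distrib[of "?p' mu s - ?p mu s"] times_divide_eq_right)
      qed
    qed
  qed
qed

text \<open>Keeping the pair \<open>(x1 mu, x2 lam)\<close> at both rates bounds
  \<open>v mu - v lam\<close> from above: at \<open>mu\<close> the strategy \<open>x1 mu\<close>
  guarantees at least \<open>v mu\<close>, and at \<open>lam\<close> the strategy
  \<open>x2 lam\<close> concedes at most \<open>v lam\<close>. The pair
  \<open>(x1 lam, x2 mu)\<close> bounds it from below. Both difference quotients tend to the same
  \<open>d\<close>, so \<open>v'\<close> equals \<open>d\<close>.\<close>

lemma envelope:
  fixes g :: "'k::finite \<Rightarrow> 'i::finite \<Rightarrow> 'j::finite \<Rightarrow> real"
  assumes lam: "0 < lam" "lam < lam0" "lam0 \<le> 1"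
    and opt1: "\<And>mu. 0 < mu \<Longrightarrow> mu \<le> lam0 \<Longrightarrow> optimal1 g q mu (stationary (x1 mu))"
    and opt2: "\<And>mu. 0 < mu \<Longrightarrow> mu \<le> lam0 \<Longrightarrow> optimal2 g q mu (stationary (x2 mu))"
    and c1: "\<And>k i. ((\<lambda>mu. pmf (x1 mu k) i) \<longlongrightarrow> pmf (x1 lam k) i) (at_right lam)"
    and c2: "\<And>k j. ((\<lambda>mu. pmf (x2 mu k) j) \<longlongrightarrow> pmf (x2 lam k) j) (at_right lam)"
    and v': "\<And>k. ((\<lambda>mu. discounted_value g q mu k) has_real_derivative v' k) (at lam)"
  defines "K \<equiv> stationary_kernel q (x1 lam) (x2 lam)"
  shows "v' s - (1 - lam) * act K v' s = reward g (x1 lam) (x2 lam) s - act K (discounted_value g q lam) s"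
proof -
  let ?v = "discounted_value g q"
  have ge: "?v mu k \<le> stationary_payoff g q mu (x1 mu) y k" if "0 < mu" "mu \<le> lam0" for mu y k
    by (rule optimal1_ge) (use that lam opt1 in auto)
  have le: "stationary_payoff g q mu x (x2 mu) k \<le> ?v mu k" if "0 < mu" "mu \<le> lam0" for mu x k
    by (rule optimal2_le) (use that lam opt2 in auto)
  have v: "?v lam = stationary_payoff g q lam (x1 lam) (x2 lam)"
  proof
    show "?v lam k = stationary_payoff g q lam (x1 lam) (x2 lam) k" for k
      by (rule antisym[OF ge le]) (use lam in auto)
  qed
  have lam1: "lam < 1" "lam \<le> 1" using lam by auto
  \<comment> \<open>The solution of the expected equation is taken first; that it is the derivative
    follows from the squeeze.\<close>
  obtain d where "\<forall>s. d s - (1 - lam) * act K d s = reward g (x1 lam) (x2 lam) s - act K (?v lam) s"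
    using resolvent_solvable[OF lam(1) lam1(2), where q = q and x = "x1 lam" and y = "x2 lam"
        and b = "\<lambda>s. reward g (x1 lam) (x2 lam) s - act K (?v lam) s"]
    unfolding K_def by (elim exE)
  then have d: "d s - (1 - lam) * act K d s = reward g (x1 lam) (x2 lam) s - act K (?v lam) s" for s
    by (rule spec)
  have ev: "\<forall>\<^sub>F mu in at_right lam. lam < mu \<and> mu \<le> lam0"
    by (rule eventually_at_rightI[of lam lam0]) (use lam in auto)
  have dq: "((\<lambda>mu. (?v mu s - ?v lam s) / (mu - lam)) \<longlongrightarrow> v' s) (at_right lam)" for s
    using v'[of s] by (auto simp: has_field_derivative_iff intro: tendsto_mono[OF at_le])
  have "v' s = d s" for s
  proof (rule antisym)
    show "v' s \<le> d s"
    proof (rule tendsto_le[OF _ _ dq])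
      show "((\<lambda>mu. (stationary_payoff g q mu (x1 mu) (x2 lam) s - stationary_payoff g q lam (x1 mu) (x2 lam) s) / (mu - lam))
        \<longlongrightarrow> d s) (at_right lam)"
        by (rule difference_quotient_tendsto[OF lam(1) lam1(1) c1 tendsto_const]) (use d in \<open>simp add: K_def v\<close>)
      show "\<forall>\<^sub>F mu in at_right lam. (?v mu s - ?v lam s) / (mu - lam) \<le>
        (stationary_payoff g q mu (x1 mu) (x2 lam) s - stationary_payoff g q lam (x1 mu) (x2 lam) s) / (mu - lam)"
        using ev
      proof eventually_elim
        case (elim mu)
        then show ?case
          using ge[of mu s "x2 lam"] le[of lam s "x1 mu"] lam by (intro divide_right_mono) auto
      qed
    qed simp
    show "d s \<le> v' s"
    proof (rule tendsto_le[OF _ dq])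
      show "((\<lambda>mu. (stationary_payoff g q mu (x1 lam) (x2 mu) s - stationary_payoff g q lam (x1 lam) (x2 mu) s) / (mu - lam))
        \<longlongrightarrow> d s) (at_right lam)"
        by (rule difference_quotient_tendsto[OF lam(1) lam1(1) tendsto_const c2]) (use d in \<open>simp add: K_def v\<close>)
      show "\<forall>\<^sub>F mu in at_right lam.
        (stationary_payoff g q mu (x1 lam) (x2 mu) s - stationary_payoff g q lam (x1 lam) (x2 mu) s) / (mu - lam)
        \<le> (?v mu s - ?v lam s) / (mu - lam)"
        using ev
      proof eventually_elim
        case (elim mu)
        then show ?case
          using le[of mu s "x1 lam"] ge[of lam s "x2 mu"] lam by (intro divide_right_mono) auto
      qed
    qed simp
  qed
  then have "v' = d" by blast
  with d show ?thesis by blast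
qed

section \<open>The limit of the cumulated payoff\<close>

lemma act_pow_linear:
  "(act K ^^ m) (\<lambda>s. a * f s + b * f' s) s = a * (act K ^^ m) f s + b * (act K ^^ m) f' s"
proof (induction m arbitrary: s)
  case (Suc m)
  have "(act K ^^ m) (\<lambda>s. a * f s + b * f' s) = (\<lambda>s. a * (act K ^^ m) f s + b * (act K ^^ m) f' s)"
    using Suc by blast
  then show ?case by (simp add: act_linear)
qed simp

text \<open>Applying powers of \<open>K\<close> to the equation and summing telescopes to
  \<open>v - K^M v = D - K^M D\<close> plus \<open>lam\<close> times the sum of \<open>K^m D\<close>
  over \<open>m = 1, ..., M\<close>. The first two terms give the \<open>2\<close>, the sum gives
  \<open>lam * M\<close>.\<close>

lemma stochastic_drift_bound:
  assumes K: "stochastic K" and lam: "0 \<le> lam" "lam \<le> (1::real)"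
    and D: "\<And>s. D s - (1 - lam) * act K D s = v s - act K v s" and e: "\<And>s. \<bar>D s\<bar> \<le> e"
  shows "\<bar>v s - (act K ^^ M) v s\<bar> \<le> (2 + lam * M) * e"
proof -
  define P where "P m f = (act K ^^ m) f s" for m f
  have P: "\<bar>P m D\<bar> \<le> e" for m unfolding P_def by (rule act_pow_abs_le[OF K e])
  have step: "P (Suc m) v = P m v - P m D + (1 - lam) * P (Suc m) D" for m
  proof -
    \<comment> \<open>The coefficients \<open>1\<close> and \<open>- 1\<close> are spelled out to
      fit the shape of \<open>act_pow_linear\<close>.\<close>
    have "act K v = (\<lambda>s. 1 * v s + 1 * ((- 1) * D s + (1 - lam) * act K D s))"
      using D by (intro ext) (simp add: algebra_simps)
    then have "P (Suc m) v = (act K ^^ m) (\<lambda>s. 1 * v s + 1 * ((- 1) * D s + (1 - lam) * act K D s)) s"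
      by (simp add: P_def funpow_swap1)
    also have "\<dots> = P m v - P m D + (1 - lam) * (act K ^^ m) (act K D) s"
      unfolding act_pow_linear P_def by simp
    finally show ?thesis by (simp add: P_def funpow_swap1)
  qed
  have "\<bar>v s - P M v - D s + P M D\<bar> \<le> lam * M * e"
  proof (induction M)
    case (Suc M)
    have "v s - P (Suc M) v - D s + P (Suc M) D = (v s - P M v - D s + P M D) + lam * P (Suc M) D"
      unfolding step by (simp add: algebra_simps)
    also have "\<bar>\<dots>\<bar> \<le> \<bar>v s - P M v - D s + P M D\<bar> + \<bar>lam * P (Suc M) D\<bar>" by (rule abs_triangle_ineq)
    also have "\<dots> \<le> lam * M * e + lam * e"
      using Suc mult_left_mono[OF P[of "Suc M"] lam(1)] lam(1) by (intro add_mono) (simp_all add: abs_mult)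
    finally show ?case by (simp add: algebra_simps)
  qed (simp add: P_def)
  moreover have "\<bar>P M D\<bar> \<le> e" "\<bar>D s\<bar> \<le> e" using P e by auto
  ultimately have "\<bar>v s - P M v\<bar> \<le> lam * M * e + 2 * e" by (simp add: abs_if split: if_splits)
  then show ?thesis by (simp add: P_def algebra_simps)
qed

section \<open>The horizon \<open>phi\<close> and the payoff up to it\<close>

lemma eta_eq: "eta lam M = 1 - (1 - lam) ^ M"
proof (induction M)
  case (Suc M)
  then show ?case by (simp add: eta_def algebra_simps)
qed (simp add: eta_def)

text \<open>Minimality of \<open>M\<close> places \<open>1 - t\<close> between
  \<open>(1 - lam) ^ M\<close> and \<open>(1 - lam) ^ (M - 1)\<close>, which differ by at most
  \<open>lam\<close>; taking logarithms of the upper one bounds \<open>lam * M\<close>.\<close>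

lemma phi_finite:
  assumes lam: "0 < lam" "lam < 1" and t: "0 \<le> t" "t < 1"
  obtains M where "phi lam t = enat M" "(1 - lam) ^ M \<le> 1 - t" "(1 - t) - lam \<le> (1 - lam) ^ M"
    "lam * M \<le> 1 - ln (1 - t)"
proof -
  define P where "P M \<longleftrightarrow> M \<ge> 1 \<and> eta lam M \<ge> t" for M
  have "(\<lambda>n. (1 - lam) ^ n) \<longlonglongrightarrow> 0" using lam by (intro LIMSEQ_realpow_zero) auto
  then have "\<forall>\<^sub>F n in sequentially. (1 - lam) ^ n < 1 - t" by (rule order_tendstoD) (use t in simp)
  then have "\<forall>\<^sub>F n in sequentially. P n"
    using eventually_ge_at_top[of 1] by eventually_elim (auto simp: P_def eta_eq)
  then have ex: "\<exists>n. P n" by (auto simp: eventually_sequentially)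
  define M where "M = (LEAST M. P M)"
  have M: "P M" unfolding M_def using ex by (rule LeastI_ex)
  have least: "M \<le> n" if "P n" for n unfolding M_def using that by (rule Least_le)
  have "phi lam t = enat M"
    unfolding phi_def
  proof (rule antisym)
    show "Inf {enat M |M. 1 \<le> M \<and> t \<le> eta lam M} \<le> enat M"
      by (rule Inf_lower) (use M in \<open>auto simp: P_def\<close>)
    show "enat M \<le> Inf {enat M |M. 1 \<le> M \<and> t \<le> eta lam M}"
      by (rule Inf_greatest) (use least in \<open>auto simp: P_def\<close>)
  qed
  moreover have "(1 - lam) ^ M \<le> 1 - t" using M by (simp add: P_def eta_eq)
  moreover have "(1 - t) - lam \<le> (1 - lam) ^ M \<and> lam * M \<le> 1 - ln (1 - t)"
  proof (cases "M = 1")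
    \<comment> \<open>The predecessor \<open>0\<close> may be excluded by the constraint
      \<open>M \<ge> 1\<close> alone, as for \<open>t = 0\<close>, so minimality gives no
      information and the bounds are checked directly.\<close>
    case True
    have "ln (1 - t) \<le> 0" using t by simp
    then show ?thesis using True lam t by (simp, linarith)
  next
    case False
    then obtain n where n: "M = Suc n" "n \<ge> 1" using M by (cases M) (auto simp: P_def)
    have "\<not> P n" using least[of n] n by auto
    then have pw: "1 - t < (1 - lam) ^ n" using n by (simp add: P_def eta_eq)
    have "(1 - t) - lam \<le> (1 - lam) * (1 - t)" using lam t by (simp add: algebra_simps)
    also have "\<dots> \<le> (1 - lam) * (1 - lam) ^ n" using pw lam by (intro mult_left_mono) auto
    finally have 1: "(1 - t) - lam \<le> (1 - lam) ^ M" by (simp add: n)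
    have "ln (1 - t) \<le> ln ((1 - lam) ^ n)" using pw t by (subst ln_le_cancel_iff) auto
    also have "\<dots> = n * ln (1 - lam)" using lam by (simp add: ln_realpow)
    also have "\<dots> \<le> n * (- lam)" using lam ln_le_minus_one[of "1 - lam"] by (intro mult_left_mono) auto
    finally have "lam * M \<le> lam - ln (1 - t)" by (simp add: n algebra_simps)
    with 1 lam show ?thesis by auto
  qed
  ultimately show thesis using that by blast
qed

text \<open>The powers of \<open>1 - lam\<close> stay positive, so \<open>eta\<close> never reaches
  \<open>1\<close>.\<close>

lemma phi_one:
  assumes "0 < lam" "lam < 1"
  shows "phi lam 1 = \<infinity>"
proof -
  have "(1 - lam) ^ M > 0" for M using assms by simp
  then have "{enat M |M. M \<ge> 1 \<and> eta lam M \<ge> 1} = {}" by (auto simp: eta_eq not_le)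
  then have "phi lam 1 = Inf {}" by (simp only: phi_def)
  then show ?thesis by (simp add: top_enat_def)
qed

text \<open>Unrolling \<open>stationary_payoff_eq\<close> over \<open>M\<close> stages: the
  subtracted term is the discounted payoff still to come after them.\<close>

lemma cumulated_payoff_finite:
  fixes g :: "'k::finite \<Rightarrow> 'i::finite \<Rightarrow> 'j::finite \<Rightarrow> real"
  assumes lam: "0 < lam" "lam \<le> 1" and phi: "phi lam t = enat M"
  shows "cumulated_payoff g q lam k (stationary x) (stationary y) t
    = stationary_payoff g q lam x y k
      - (1 - lam) ^ M * (act (stationary_kernel q x y) ^^ M) (stationary_payoff g q lam x y) k"
proof -
  let ?K = "stationary_kernel q x y" and ?v = "stationary_payoff g q lam x y" and ?r = "reward g x y"
  \<comment> \<open>Index \<open>m\<close> stands for stage \<open>m + 1\<close>, hence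
    \<open>Suc m \<le> M\<close>.\<close>
  define a where "a m = (if Suc m \<le> M then lam * (1 - lam) ^ m else 0)" for m
  have a: "summable (\<lambda>m. \<bar>a m\<bar>)"
    by (rule summable_finite[of "{..<M}"]) (auto simp: a_def)
  have "cumulated_payoff g q lam k (stationary x) (stationary y) t
    = (\<integral>\<omega>. (\<Sum>m. a m * (case \<omega> m of (s, i, j) \<Rightarrow> g s i j)) \<partial>play_measure q k (stationary x) (stationary y))"
    unfolding cumulated_payoff_def phi
    by (intro Bochner_Integration.integral_cong suminf_cong refl) (simp add: a_def)
  also have "\<dots> = (\<Sum>m. a m * stage_payoff g q k (stationary x) (stationary y) m)"
    by (rule integral_weighted_payoff[OF a])
  also have "\<dots> = (\<Sum>m<M. a m * stage_payoff g q k (stationary x) (stationary y) m)"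
    by (rule suminf_finite) (auto simp: a_def)
  also have "\<dots> = (\<Sum>m<M. lam * (1 - lam) ^ m * (act ?K ^^ m) ?r k)"
    by (intro sum.cong) (auto simp: a_def stage_payoff_stationary)
  also have "\<dots> = ?v k - (1 - lam) ^ M * (act ?K ^^ M) ?v k"
  proof (induction M)
    case (Suc M)
    have "?v = (\<lambda>s. lam * ?r s + (1 - lam) * act ?K ?v s)"
      using stationary_payoff_eq[OF lam] by blast
    then have "(act ?K ^^ M) ?v k = (act ?K ^^ M) (\<lambda>s. lam * ?r s + (1 - lam) * act ?K ?v s) k" by metis
    also have "\<dots> = lam * (act ?K ^^ M) ?r k + (1 - lam) * (act ?K ^^ Suc M) ?v k"
      unfolding act_pow_linear by (simp add: funpow_swap1)
    finally have "(act ?K ^^ M) ?v k = lam * (act ?K ^^ M) ?r k + (1 - lam) * (act ?K ^^ Suc M) ?v k" .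
    then have "(1 - lam) ^ M * (act ?K ^^ M) ?v k = lam * (1 - lam) ^ M * (act ?K ^^ M) ?r k
       + (1 - lam) ^ Suc M * (act ?K ^^ Suc M) ?v k"
      by (simp add: distrib_left mult_ac)
    with Suc show ?case by simp
  qed simp
  finally show ?thesis .
qed

lemma cumulated_payoff_infinite:
  assumes "phi lam t = \<infinity>"
  shows "cumulated_payoff g q lam k \<sigma>1 \<sigma>2 t = discounted_payoff g q lam k \<sigma>1 \<sigma>2"
  unfolding cumulated_payoff_def discounted_payoff_def assms by simp

text \<open>The product of the finitely many individual denominators is a common multiple of
  them.\<close>

lemma puiseux_family_common_root:
  fixes f :: "'a::finite \<Rightarrow> real \<Rightarrow> real"
  assumes "\<And>a. puiseux_on lam0 (f a)" "lam0 > 0"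
  obtains N where "N \<ge> 1" "\<And>a n. N dvd n \<Longrightarrow> n \<ge> 1 \<Longrightarrow> quotient_germ (\<lambda>s. f a (s ^ n))"
proof -
  have "\<exists>N\<ge>1. \<forall>n. N dvd n \<longrightarrow> n \<ge> 1 \<longrightarrow> quotient_germ (\<lambda>s. f a (s ^ n))" for a
    by (rule puiseux_on_quotient_germ[OF assms(1)[of a] assms(2)]) blast
  then obtain N where N: "\<And>a. N a \<ge> 1" "\<And>a n. N a dvd n \<Longrightarrow> n \<ge> 1 \<Longrightarrow> quotient_germ (\<lambda>s. f a (s ^ n))"
    by metis
  show thesis
  proof (rule that[of "\<Prod>a\<in>UNIV. N a"])
    have "(\<Prod>a\<in>UNIV. N a) > 0" using N(1) by (intro prod_pos) (auto simp: Suc_le_eq)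
    then show "(\<Prod>a\<in>UNIV. N a) \<ge> 1" by linarith
    show "quotient_germ (\<lambda>s. f a (s ^ n))" if "(\<Prod>a\<in>UNIV. N a) dvd n" "n \<ge> 1" for a n
      by (rule N(2)) (use that dvd_prodI[of UNIV a N] dvd_trans in auto)
  qed
qed

lemma eventually_at_right_0_pow:
  assumes "\<forall>\<^sub>F x::real in at_right 0. P x" "N \<ge> 1"
  shows "\<forall>\<^sub>F s in at_right 0. P (s ^ N)"
proof -
  have "((\<lambda>s::real. s ^ N) \<longlongrightarrow> 0 ^ N) (at_right 0)" by (intro tendsto_power tendsto_ident_at)
  then have "filterlim (\<lambda>s::real. s ^ N) (at_right 0) (at_right 0)"
    using assms(2) by (auto simp: filterlim_at power_0_left intro: eventually_mono[OF eventually_at_right_less[of "0::real"]])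
  with assms(1) show ?thesis by (rule eventually_compose_filterlim)
qed

lemma quotient_germ_mixed:
  assumes "\<And>i. quotient_germ (\<lambda>s. pmf (p1 s) i)" "\<And>j. quotient_germ (\<lambda>s. pmf (p2 s) j)"
  shows "quotient_germ (\<lambda>s. mixed (p1 s) (p2 s) A)"
  unfolding mixed_def by (intro quotient_germ_sum quotient_germ_mult quotient_germ_const assms)

theorem theorem3p1:
  fixes g :: "'k::finite \<Rightarrow> 'i::finite \<Rightarrow> 'j::finite \<Rightarrow> real"
    and q :: "'k \<Rightarrow> 'i \<Rightarrow> 'j \<Rightarrow> 'k pmf"
    and x1 :: "real \<Rightarrow> 'k \<Rightarrow> 'i pmf"
    and x2 :: "real \<Rightarrow> 'k \<Rightarrow> 'j pmf"
  assumes "optimal_puiseux_profile g q x1 x2"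
  shows "\<forall>t\<in>{0..1}. \<forall>k.
    ((\<lambda>lam. cumulated_payoff g q lam k (stationary (x1 lam)) (stationary (x2 lam)) t)
       \<longlongrightarrow> t * limit_value g q k) (at_right 0)"
proof (intro ballI allI)
  fix t :: real and k :: 'k assume t: "t \<in> {0..1}"
  let ?v = "discounted_value g q"
  let ?K = "\<lambda>lam. stationary_kernel q (x1 lam) (x2 lam)" and ?r = "\<lambda>lam. reward g (x1 lam) (x2 lam)"
  obtain lam0 where lam0: "0 < lam0" "lam0 \<le> 1" and profile: "puiseux_profile_on lam0 x1 x2"
    and opt: "\<And>lam. 0 < lam \<Longrightarrow> lam \<le> lam0 \<Longrightarrow> optimal1 g q lam (stationary (x1 lam))"
      "\<And>lam. 0 < lam \<Longrightarrow> lam \<le> lam0 \<Longrightarrow> optimal2 g q lam (stationary (x2 lam))"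
    using assms unfolding optimal_puiseux_profile_def by auto
  have v: "?v lam = stationary_payoff g q lam (x1 lam) (x2 lam)" if "0 < lam" "lam \<le> lam0" for lam
    using that lam0 opt by (intro ext antisym optimal1_ge optimal2_le) auto
  have small: "\<forall>\<^sub>F lam in at_right 0. 0 < lam \<and> lam < lam0"
    by (rule eventually_at_rightI[of 0 lam0]) (use lam0 in auto)
  obtain N1 where N1: "N1 \<ge> 1" "\<And>a n. N1 dvd n \<Longrightarrow> n \<ge> 1 \<Longrightarrow> quotient_germ (\<lambda>s. pmf (x1 (s ^ n) (fst a)) (snd a))"
    by (rule puiseux_family_common_root[of lam0 "\<lambda>a lam. pmf (x1 lam (fst a)) (snd a)"])
      (use profile lam0 in \<open>auto simp: puiseux_profile_on_def\<close>)
  obtain N2 where N2: "N2 \<ge> 1" "\<And>a n. N2 dvd n \<Longrightarrow> n \<ge> 1 \<Longrightarrow> quotient_germ (\<lambda>s. pmf (x2 (s ^ n) (fst a)) (snd a))"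
    by (rule puiseux_family_common_root[of lam0 "\<lambda>a lam. pmf (x2 lam (fst a)) (snd a)"])
      (use profile lam0 in \<open>auto simp: puiseux_profile_on_def\<close>)
  define N where "N = N1 * N2"
  have N: "N \<ge> 1" using N1(1) N2(1) by (simp add: N_def)
  have X1: "quotient_germ (\<lambda>s. pmf (x1 (s ^ N) k) i)" for k i
    using N1(2)[of N "(k, i)"] N by (simp add: N_def)
  have X2: "quotient_germ (\<lambda>s. pmf (x2 (s ^ N) k) j)" for k j
    using N2(2)[of N "(k, j)"] N by (simp add: N_def)
  \<comment> \<open>The value is the payoff of the optimal pair, so it solves a linear system whose
    coefficients are germs in \<open>s\<close>.\<close>
  have V: "quotient_germ (\<lambda>s. ?v (s ^ N) k)" for k
  proof (rule quotient_germ_resolvent[where K = "\<lambda>s. ?K (s ^ N)" and lam = "\<lambda>s. s ^ N" and b = "\<lambda>s k. s ^ N * ?r (s ^ N) k"])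
    show "quotient_germ (\<lambda>s. ?K (s ^ N) i j)" for i j
      unfolding stationary_kernel_def by (intro quotient_germ_mixed X1 X2)
    show "quotient_germ (\<lambda>s. s ^ N * ?r (s ^ N) i)" for i
      unfolding reward_def by (intro quotient_germ_mult quotient_germ_power quotient_germ_mixed X1 X2)
    have "\<forall>\<^sub>F lam in at_right 0. 0 < lam \<and> lam \<le> 1 \<and> stochastic (?K lam) \<and>
      (\<forall>i. ?v lam i - (1 - lam) * act (?K lam) (?v lam) i = lam * ?r lam i)"
      using small
    proof eventually_elim
      case (elim lam)
      then have "lam \<le> 1" using lam0 by auto
      have "?v lam i = lam * ?r lam i + (1 - lam) * act (?K lam) (?v lam) i" for i
        unfolding v[OF conjunct1[OF elim] less_imp_le[OF conjunct2[OF elim]]]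
        using elim \<open>lam \<le> 1\<close> by (intro stationary_payoff_eq) auto
      with elim \<open>lam \<le> 1\<close> show ?case by (auto simp: stochastic_stationary_kernel algebra_simps)
    qed
    from eventually_at_right_0_pow[OF this N]
    show "\<forall>\<^sub>F s in at_right 0. 0 < s ^ N \<and> s ^ N \<le> 1 \<and> stochastic (?K (s ^ N)) \<and>
      (\<forall>i. ?v (s ^ N) i - (1 - s ^ N) * act (?K (s ^ N)) (?v (s ^ N)) i = s ^ N * ?r (s ^ N) i)" .
  qed simp
  obtain B where B: "B \<ge> 0" "\<And>s i j. \<bar>g s i j\<bar> \<le> B" using payoff_bounded by blast
  have vB: "\<bar>?v lam k\<bar> \<le> B" if "0 < lam" "lam < lam0" for lam k
    unfolding v[OF that(1) less_imp_le[OF that(2)]] using that lam0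
    by (intro discounted_payoff_abs_le B) auto
  have "\<forall>\<^sub>F lam in at_right 0. \<bar>?v lam k\<bar> \<le> B" for k
    using small by eventually_elim (simp add: vB)
  then have vB': "\<forall>\<^sub>F s in at_right 0. \<bar>?v (s ^ N) k\<bar> \<le> B" for k
    by (rule eventually_at_right_0_pow[where P = "\<lambda>lam. \<bar>?v lam k\<bar> \<le> B", OF _ N])
  have "\<forall>k. \<exists>L f'. (((\<lambda>lam. ?v lam k) \<longlongrightarrow> L) (at_right 0)) \<and>
      (\<forall>\<^sub>F lam in at_right 0. ((\<lambda>lam. ?v lam k) has_real_derivative f' lam) (at lam)) \<and>
      ((\<lambda>lam. lam * f' lam) \<longlongrightarrow> 0) (at_right 0)"
  proof
    fix k
    show "\<exists>L f'. (((\<lambda>lam. ?v lam k) \<longlongrightarrow> L) (at_right 0)) \<and>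
      (\<forall>\<^sub>F lam in at_right 0. ((\<lambda>lam. ?v lam k) has_real_derivative f' lam) (at lam)) \<and>
      ((\<lambda>lam. lam * f' lam) \<longlongrightarrow> 0) (at_right 0)"
      by (rule bounded_germ_asymptotics[where f = "\<lambda>lam. ?v lam k" and N = N and B = B, OF V N vB'])
        (intro exI conjI)
  qed
  from choice[OF this] obtain L where "\<forall>k. \<exists>f'. (((\<lambda>lam. ?v lam k) \<longlongrightarrow> L k) (at_right 0)) \<and>
      (\<forall>\<^sub>F lam in at_right 0. ((\<lambda>lam. ?v lam k) has_real_derivative f' lam) (at lam)) \<and>
      ((\<lambda>lam. lam * f' lam) \<longlongrightarrow> 0) (at_right 0)" ..
  from choice[OF this] obtain v' where "\<forall>k. (((\<lambda>lam. ?v lam k) \<longlongrightarrow> L k) (at_right 0)) \<and>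
      (\<forall>\<^sub>F lam in at_right 0. ((\<lambda>lam. ?v lam k) has_real_derivative v' k lam) (at lam)) \<and>
      ((\<lambda>lam. lam * v' k lam) \<longlongrightarrow> 0) (at_right 0)" ..
  then have L: "\<And>k. ((\<lambda>lam. ?v lam k) \<longlongrightarrow> L k) (at_right 0)"
    and v': "\<And>k. \<forall>\<^sub>F lam in at_right 0. ((\<lambda>lam. ?v lam k) has_real_derivative v' k lam) (at lam)"
      "\<And>k. ((\<lambda>lam. lam * v' k lam) \<longlongrightarrow> 0) (at_right 0)"
    by simp_all
  have lv: "limit_value g q k = L k"
    unfolding limit_value_def by (rule tendsto_Lim[OF _ L]) simp
  \<comment> \<open>Probabilities are bounded germs, hence differentiable at all small
    \<open>lam\<close>; this supplies the right-continuity of the strategies that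
    \<open>envelope\<close> requires.\<close>
  have cont: "\<forall>\<^sub>F lam in at_right 0. (f \<longlongrightarrow> f lam) (at_right lam)"
    if germ: "quotient_germ (\<lambda>s. f (s ^ N))" and "\<And>lam. \<bar>f lam\<bar> \<le> 1" for f
  proof -
    have bd: "\<forall>\<^sub>F s in at_right 0. \<bar>f (s ^ N)\<bar> \<le> 1" by (simp add: that(2))
    obtain f' where "\<forall>\<^sub>F lam in at_right 0. (f has_real_derivative f' lam) (at lam)"
      by (rule bounded_germ_asymptotics[where f = f and N = N and B = 1, OF germ N bd])
    then show ?thesis
    proof eventually_elim
      case (elim lam)
      then have "isCont f lam" by (rule DERIV_isCont)
      then show ?case unfolding isCont_def by (rule tendsto_mono[OF at_le, rotated]) simp
    qed
  qed
  have c1: "\<forall>\<^sub>F lam in at_right 0. \<forall>k i. ((\<lambda>mu. pmf (x1 mu k) i) \<longlongrightarrow> pmf (x1 lam k) i) (at_right lam)"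
  proof (intro eventually_all_finite)
    show "\<forall>\<^sub>F lam in at_right 0. ((\<lambda>mu. pmf (x1 mu k) i) \<longlongrightarrow> pmf (x1 lam k) i) (at_right lam)" for k i
      by (rule cont[where f = "\<lambda>lam. pmf (x1 lam k) i", OF X1]) (simp add: pmf_le_1)
  qed
  have c2: "\<forall>\<^sub>F lam in at_right 0. \<forall>k j. ((\<lambda>mu. pmf (x2 mu k) j) \<longlongrightarrow> pmf (x2 lam k) j) (at_right lam)"
  proof (intro eventually_all_finite)
    show "\<forall>\<^sub>F lam in at_right 0. ((\<lambda>mu. pmf (x2 mu k) j) \<longlongrightarrow> pmf (x2 lam k) j) (at_right lam)" for k j
      by (rule cont[where f = "\<lambda>lam. pmf (x2 lam k) j", OF X2]) (simp add: pmf_le_1)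
  qed
  have d: "\<forall>\<^sub>F lam in at_right 0. \<forall>k. ((\<lambda>lam. ?v lam k) has_real_derivative v' k lam) (at lam)"
    by (intro eventually_all_finite v')
  \<comment> \<open>A single bound on \<open>\<bar>lam * v' k lam\<bar>\<close> for all states; it
    tends to \<open>0\<close> because there are finitely many of them.\<close>
  define e where "e lam = (\<Sum>k\<in>UNIV. \<bar>lam * v' k lam\<bar>)" for lam
  have "(e \<longlongrightarrow> (\<Sum>k\<in>(UNIV::'k set). \<bar>0\<bar>)) (at_right 0)"
    unfolding e_def by (intro tendsto_intros v')
  then have e: "(e \<longlongrightarrow> 0) (at_right 0)" by simp
  have drift: "\<forall>\<^sub>F lam in at_right 0. \<forall>M. \<bar>?v lam k - (act (?K lam) ^^ M) (?v lam) k\<bar> \<le> (2 + lam * M) * e lam"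
    using small c1 c2 d
  proof eventually_elim
    case (elim lam)
    have lam: "0 < lam" "lam < lam0" "lam \<le> lam0" "lam \<le> 1" using elim(1) lam0 by auto
    have env: "v' s lam - (1 - lam) * act (?K lam) (\<lambda>s. v' s lam) s = ?r lam s - act (?K lam) (?v lam) s" for s
      by (rule envelope[OF lam(1,2) lam0(2)]) (use opt elim in auto)
    show ?case
    proof
      fix M
      show "\<bar>?v lam k - (act (?K lam) ^^ M) (?v lam) k\<bar> \<le> (2 + lam * M) * e lam"
      proof (rule stochastic_drift_bound[OF stochastic_stationary_kernel, where D = "\<lambda>s. lam * v' s lam"])
        \<comment> \<open>The envelope formula times \<open>lam\<close>, with
          \<open>lam * ?r lam s\<close> eliminated through the payoff equation.\<close>
        show "lam * v' s lam - (1 - lam) * act (?K lam) (\<lambda>s. lam * v' s lam) s = ?v lam s - act (?K lam) (?v lam) s" for s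
        proof -
          have "act (?K lam) (\<lambda>s. lam * v' s lam) s = lam * act (?K lam) (\<lambda>s. v' s lam) s"
            using act_linear[of "?K lam" lam "\<lambda>s. v' s lam" 0 "\<lambda>s. 0" s] by simp
          then have "lam * v' s lam - (1 - lam) * act (?K lam) (\<lambda>s. lam * v' s lam) s
            = lam * (v' s lam - (1 - lam) * act (?K lam) (\<lambda>s. v' s lam) s)" by (simp add: algebra_simps)
          also have "\<dots> = lam * ?r lam s - lam * act (?K lam) (?v lam) s" unfolding env by (simp add: algebra_simps)
          also have "lam * ?r lam s = ?v lam s - (1 - lam) * act (?K lam) (?v lam) s"
            using stationary_payoff_eq[OF lam(1,4), where g = g and q = q and x = "x1 lam" and y = "x2 lam" and k = s]
              fun_cong[OF v[OF lam(1,3)], of s]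
            unfolding v[OF lam(1,3), symmetric] by simp
          finally show ?thesis by (simp add: algebra_simps)
        qed
        show "\<bar>lam * v' s lam\<bar> \<le> e lam" for s
          unfolding e_def by (rule member_le_sum) auto
      qed (use lam in auto)
    qed
  qed
  show "((\<lambda>lam. cumulated_payoff g q lam k (stationary (x1 lam)) (stationary (x2 lam)) t)
       \<longlongrightarrow> t * limit_value g q k) (at_right 0)"
  proof (cases "t = 1")
    case True
    have "\<forall>\<^sub>F lam in at_right 0. ?v lam k = cumulated_payoff g q lam k (stationary (x1 lam)) (stationary (x2 lam)) t"
      using small
    proof eventually_elim
      case (elim lam)
      then have "phi lam 1 = \<infinity>" using lam0 by (intro phi_one) auto
      with elim show ?case by (simp add: True v cumulated_payoff_infinite)
    qed
    with L[of k] show ?thesis by (simp add: lv True Lim_transform_eventually)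
  next
    case False
    then have t': "0 \<le> t" "t < 1" using t by auto
    \<comment> \<open>The factor \<open>2 + lam * M\<close> of the drift bound, with
      \<open>lam * M\<close> replaced by its bound from \<open>phi_finite\<close>.\<close>
    define C where "C = 2 + (1 - ln (1 - t))"
    have "((\<lambda>lam. C * e lam + lam * B) \<longlongrightarrow> C * 0 + 0 * B) (at_right 0)"
      by (intro tendsto_intros e)
    then have lim0: "((\<lambda>lam. C * e lam + lam * B) \<longlongrightarrow> 0) (at_right 0)" by simp
    have "((\<lambda>lam. cumulated_payoff g q lam k (stationary (x1 lam)) (stationary (x2 lam)) t - t * ?v lam k) \<longlongrightarrow> 0) (at_right 0)"
    proof (rule Lim_null_comparison[OF _ lim0])
      show "\<forall>\<^sub>F lam in at_right 0. norm (cumulated_payoff g q lam k (stationary (x1 lam)) (stationary (x2 lam)) t - t * ?v lam k)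
        \<le> C * e lam + lam * B"
        using small drift
      proof eventually_elim
        case (elim lam)
        have lam: "0 < lam" "lam < 1" "lam \<le> 1" "lam < lam0" "lam \<le> lam0" using elim(1) lam0 by auto
        obtain M where M: "phi lam t = enat M" "(1 - lam) ^ M \<le> 1 - t" "(1 - t) - lam \<le> (1 - lam) ^ M"
          "lam * M \<le> 1 - ln (1 - t)"
          using phi_finite[OF lam(1,2) t'] by blast
        let ?w = "(act (?K lam) ^^ M) (?v lam) k" and ?p = "(1 - lam) ^ M"
        have "0 \<le> e lam" unfolding e_def by (intro sum_nonneg) simp
        have "\<bar>?v lam k - ?w\<bar> \<le> (2 + lam * M) * e lam" using elim(2) by blast
        also have "\<dots> \<le> C * e lam" unfolding C_def using M(4) \<open>0 \<le> e lam\<close> by (intro mult_right_mono) auto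
        finally have w: "\<bar>?v lam k - ?w\<bar> \<le> C * e lam" .
        \<comment> \<open>The first term is controlled by the drift bound, the second by the
          distance at most \<open>lam\<close> between \<open>(1 - lam) ^ M\<close> and
          \<open>1 - t\<close>.\<close>
        have "cumulated_payoff g q lam k (stationary (x1 lam)) (stationary (x2 lam)) t - t * ?v lam k
          = ?p * (?v lam k - ?w) + ((1 - t) - ?p) * ?v lam k"
          unfolding cumulated_payoff_finite[OF lam(1,3) M(1)] v[OF lam(1,5)] by (simp add: algebra_simps)
        also have "\<bar>\<dots>\<bar> \<le> 1 * (C * e lam) + lam * B"
        proof (rule order_trans[OF abs_triangle_ineq add_mono])
          show "\<bar>?p * (?v lam k - ?w)\<bar> \<le> 1 * (C * e lam)"
            unfolding abs_mult by (rule mult_mono) (use w lam in \<open>auto simp: power_abs power_le_one\<close>)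
          show "\<bar>((1 - t) - ?p) * ?v lam k\<bar> \<le> lam * B"
            unfolding abs_mult by (rule mult_mono) (use M vB[OF lam(1,4)] lam in auto)
        qed
        finally show ?case by simp
      qed
    qed
    from tendsto_add[OF this tendsto_mult[OF tendsto_const[of t] L[of k]]]
    show ?thesis by (simp add: lv)
  qed
qed

end
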